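(* There exist universal constants $c_1,c_2,c_3,c_4>0$ such that the following holds. Let $I=[0,1]$, let $T=\{t_1<\dots<t_k\}\subset(0,1)$, let $\sigma,\eta>0$, let $m\ge 2k+2$, let $S=\{s_1<\dots<s_m\}\subset\mathbb{R}$, and let $\phi_j(t)=e^{-(t-s_j)^2/\sigma^2}$. Assume the Gaussian window conditions (G1)-(G4) of the context. Fix positive constants $\bar f,f_1$ with $\bar f<1$. Then for every $\epsilon\in(0,\Delta(T)/2]$ there is a threshold $f_0^*\ge\max\{1,f_1\}$, depending only on $k,T,S,\sigma,\bar f,f_1,\epsilon$, such that for every $f_0>f_0^*$ the following holds, provided $\eta$ is small enough in the sense of condition (E) of the context. (i) For every $x=\sum_{i=1}^k a_i\delta_{t_i}$ with all $a_i>0$, every $\delta\ge 0$, every noise vector $(\delta_j)_{j=1}^m$ with $\sum_j\delta_j^2\le\delta^2$, and every solution $\hat x$ of the Program with $\delta'=\delta$ and data $y_j=\int_I\phi_j(t)\,x(dt)+\delta_j$, $$d_{GW}(x,\hat x)\le F_1\cdot\delta+\|x\|_{TV}\cdot\epsilon,$$ where $$F_1=\left(\Big(6+\frac{2}{\bar f}\Big)\sqrt{4k+5+\frac{4k}{\sigma^4}}\;\bar C^{5/4}+\frac{6}{\eta}(\bar C+2k)^{3/2}\right)\frac{\sqrt{2k+2}}{1-\frac{\sqrt e}{2}}\left(\frac{F_{\max}}{F_{\min}^2}\right)^k .$$ (ii) In particular, for $\sigma<\frac1{\sqrt3}$ and $\Delta(T)>\sigma\sqrt{\log\frac{5}{\sigma^2}}$,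 $$F_1<\frac{c_1\,k\,C_1(\frac1\epsilon)}{\eta\,\sigma^2}\left[\frac{c_2}{\sigma^6(1-3\sigma^2)^2}\right]^k,\qquad C_1\Big(\frac1\epsilon\Big)=\frac{(\bar C+2k)^{3/2}}{\bar f},$$ if $$\eta\le\min\left\{\frac{c_3\,\sigma^6(1-3\sigma^2)}{(k+1)^{3/2}},\ \frac{c_4\,\bar C^{1/6}\sigma^{2/3}}{(k+1)^{1/3}}\right\}.$$
   Context: Minimum separation: $\Delta=\Delta(T)$ is the smallest distance between two distinct points of $T\cup\{0,1\}$. Program with parameter $\delta'$: find a non-negative Borel measure $z$ on $I$ with $\|y-\int_I\Phi(t)z(dt)\|_2\le\delta'$, where $\Phi=(\phi_1,\dots,\phi_m)^T$ and $y=(y_1,\dots,y_m)^T$. A solution is any such $z$. $\|z\|_{TV}=\int_I|z(dt)|$. For non-negative measures of equal mass, $d_W(z_1,z_2)=\inf_\gamma\int_{I\times I}|\tau_1-\tau_2|\,\gamma(d\tau_1,d\tau_2)$ over measures $\gamma$ on $I\times I$ with marginals $z_1,z_2$. The generalised Wasserstein distance is $d_{GW}(x_1,x_2)=\inf_{z_1,z_2}\left(\|x_1-z_1\|_{TV}+d_W(z_1,z_2)+\|x_2-z_2\|_{TV}\right)$ over non-negative Borel measures $z_1,z_2$ on $I$ with $\|z_1\|_{TV}=\|z_2\|_{TV}$. Gaussian window conditions: (G1) $s_1=0$ and $s_m=1$. (G2) For every $i\in\{1,\dots,k\}$ there is a pair of samples $s,s'\in S$, one on each side of $t_i$, such that $|s-t_i|\le\eta$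 and $s'-s\in[\kappa_1\eta,\kappa_2\eta]$, for some $\kappa_1\in(0,1]$ and $\kappa_2\in[1,2)$; moreover $\eta\le\sigma^2$. (G3) $\sigma\sqrt{\log(1/\eta^3)}\le t_i,s_j\le 1-\sigma\sqrt{\log(1/\eta^3)}$ for all $i\in\{1,\dots,k\}$ and $j\in\{2,\dots,m-1\}$. (G4) $\sigma\le\sqrt2$ and $\Delta(T)>\sigma\sqrt{\log(3+4/\sigma^2)}$. Quantities: $\bar C=\bar C(f_0,f_1)=f_0^2+f_1^2+2f_0+2f_1+2$, $P=\frac{4}{\sigma^4}+\frac{13}{4}\left(\frac{2}{\sigma^2}+\frac{4}{\sigma^4}\right)^2+\frac94\left(\frac{12}{\sigma^4}+\frac{8}{\sigma^6}\right)^2$, $F_{\max}=\left(8+\left(1+\frac4{\sigma^4}\right)\frac{2}{1-e^{-\Delta^2/\sigma^2}}\right)^{1/2}\left(32+\left(\frac1{\sigma^4}+\frac2{\sigma^6}+\frac2{\sigma^8}\right)\frac{16}{1-e^{-\Delta^2/\sigma^2}}\right)^{1/2}$, $F_{\min}=1-\left(1+\frac2{\sigma^2}\right)\frac{2e^{-\Delta^2/\sigma^2}}{1-e^{-\Delta^2/\sigma^2}}$. Condition (E): $$\eta\le\min\left\{\frac{8F_{\min}}{34(2k+2)\left(80k+8+kP\,\frac{2}{1-e^{-\Delta^2/\sigma^2}}\right)^{1/2}},\ \frac{\bar C^{1/6}}{\left(4k+4+\frac{4k}{\sigma^2}\right)^{1/3}}\right\}.$$ *)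

theory Defs
  imports "HOL-Probability.Probability"
begin

section \<open>Measures on the unit interval\<close>

abbreviation unit_borel :: "real measure" where
  "unit_borel \<equiv> restrict_space borel {0..1}"

text \<open>
  Finiteness is built in because the Bochner integral of a non-integrable function is 0, so that
  a measure of infinite mass could spuriously solve the program below. Nothing is lost: Gaussian
  windows are bounded away from 0 on the unit interval, so a measure of infinite mass has infinite
  Gaussian moments and never is a solution.
\<close>

definition nonneg_measures :: "real measure set" where
  "nonneg_measures = {z. sets z = sets unit_borel \<and> finite_measure z}"

text \<open>
  Total variation of a signed measure, given as a real-valued set function: the supremum of
  \<open>\<Sum>\<bar>\<mu> A\<bar>\<close> over the finite Borel partitions of the unit interval.
\<close>

definition tv_norm :: "(real set \<Rightarrow> real) \<Rightarrow> real" where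
  "tv_norm \<mu> =
     (SUP P \<in> {P. finite P \<and> partition_on {0..1} P \<and> P \<subseteq> sets unit_borel}. \<Sum>A\<in>P. \<bar>\<mu> A\<bar>)"

definition couplings :: "real measure \<Rightarrow> real measure \<Rightarrow> (real \<times> real) measure set" where
  "couplings z1 z2 =
     {\<gamma>. sets \<gamma> = sets (unit_borel \<Otimes>\<^sub>M unit_borel) \<and>
         distr \<gamma> unit_borel fst = z1 \<and> distr \<gamma> unit_borel snd = z2}"

definition d_W :: "real measure \<Rightarrow> real measure \<Rightarrow> real" where
  "d_W z1 z2 = (INF \<gamma> \<in> couplings z1 z2. \<integral>p. \<bar>fst p - snd p\<bar> \<partial>\<gamma>)"

definition d_GW :: "real measure \<Rightarrow> real measure \<Rightarrow> real" where
  "d_GW x1 x2 =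
     (INF (z1, z2) \<in> {(z1, z2). z1 \<in> nonneg_measures \<and> z2 \<in> nonneg_measures \<and>
                               tv_norm (measure z1) = tv_norm (measure z2)}.
        tv_norm (\<lambda>A. measure x1 A - measure z1 A) + d_W z1 z2
          + tv_norm (\<lambda>A. measure x2 A - measure z2 A))"

definition discrete_measure :: "nat \<Rightarrow> (nat \<Rightarrow> real) \<Rightarrow> (nat \<Rightarrow> real) \<Rightarrow> real measure" where
  "discrete_measure k a t =
     measure_of (space unit_borel) (sets unit_borel)
       (\<lambda>A. \<Sum>i=1..k. ennreal (a i) * emeasure (return unit_borel (t i)) A)"


section \<open>Sampling and the feasibility program\<close>

definition gauss_window :: "real \<Rightarrow> (nat \<Rightarrow> real) \<Rightarrow> nat \<Rightarrow> real \<Rightarrow> real" where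
  "gauss_window \<sigma> s j t = exp (- ((t - s j)\<^sup>2 / \<sigma>\<^sup>2))"

definition is_solution ::
  "nat \<Rightarrow> (nat \<Rightarrow> real \<Rightarrow> real) \<Rightarrow> (nat \<Rightarrow> real) \<Rightarrow> real \<Rightarrow> real measure \<Rightarrow> bool" where
  "is_solution m \<phi> y \<delta>' z \<longleftrightarrow>
     z \<in> nonneg_measures \<and> L2_set (\<lambda>j. y j - (\<integral>t. \<phi> j t \<partial>z)) {1..m} \<le> \<delta>'"

definition min_sep :: "real set \<Rightarrow> real" where
  "min_sep T = Min {\<bar>u - v\<bar> | u v. u \<in> T \<union> {0, 1} \<and> v \<in> T \<union> {0, 1} \<and> u \<noteq> v}"

text \<open>
  In the second condition \<open>s j' - s j > 0\<close>, so ``one on each side'' puts \<open>s j\<close> to the left of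
  \<open>t i\<close>. In the third one, \<open>ln (1 / \<eta> ^ 3)\<close> is meant to be non-negative; this is the case
  whenever \<open>eta_small\<close> below holds, since that forces \<open>\<eta> < 1\<close>.
\<close>

definition gaussian_conditions ::
  "nat \<Rightarrow> (nat \<Rightarrow> real) \<Rightarrow> nat \<Rightarrow> (nat \<Rightarrow> real) \<Rightarrow> real \<Rightarrow> real \<Rightarrow> bool" where
  "gaussian_conditions k t m s \<sigma> \<eta> \<longleftrightarrow>
     (s 1 = 0 \<and> s m = 1) \<and>
     ((\<exists>\<kappa>1 \<in> {0<..1}. \<exists>\<kappa>2 \<in> {1..<2}. \<forall>i\<in>{1..k}. \<exists>j\<in>{1..m}. \<exists>j'\<in>{1..m}.
         s j < t i \<and> t i < s j' \<and> \<bar>s j - t i\<bar> \<le> \<eta> \<and> s j' - s j \<in> {\<kappa>1 * \<eta>..\<kappa>2 * \<eta>}) \<and>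
      \<eta> \<le> \<sigma>\<^sup>2) \<and>
     ((\<forall>i\<in>{1..k}. t i \<in> {\<sigma> * sqrt (ln (1 / \<eta> ^ 3))..1 - \<sigma> * sqrt (ln (1 / \<eta> ^ 3))}) \<and>
      (\<forall>j\<in>{2..m - 1}. s j \<in> {\<sigma> * sqrt (ln (1 / \<eta> ^ 3))..1 - \<sigma> * sqrt (ln (1 / \<eta> ^ 3))})) \<and>
     (\<sigma> \<le> sqrt 2 \<and> min_sep (t ` {1..k}) > \<sigma> * sqrt (ln (3 + 4 / \<sigma>\<^sup>2)))"


section \<open>The explicit constants\<close>

text \<open>Below, \<open>D\<close> stands for the minimum separation of the support.\<close>

definition C_bar :: "real \<Rightarrow> real \<Rightarrow> real" where
  "C_bar f0 f1 = f0\<^sup>2 + f1\<^sup>2 + 2 * f0 + 2 * f1 + 2"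

definition P_const :: "real \<Rightarrow> real" where
  "P_const \<sigma> = 4 / \<sigma> ^ 4 + 13 / 4 * (2 / \<sigma>\<^sup>2 + 4 / \<sigma> ^ 4)\<^sup>2
     + 9 / 4 * (12 / \<sigma> ^ 4 + 8 / \<sigma> ^ 6)\<^sup>2"

definition F_max :: "real \<Rightarrow> real \<Rightarrow> real" where
  "F_max D \<sigma> =
     sqrt (8 + (1 + 4 / \<sigma> ^ 4) * (2 / (1 - exp (- (D\<^sup>2 / \<sigma>\<^sup>2))))) *
     sqrt (32 + (1 / \<sigma> ^ 4 + 2 / \<sigma> ^ 6 + 2 / \<sigma> ^ 8) * (16 / (1 - exp (- (D\<^sup>2 / \<sigma>\<^sup>2)))))"

definition F_min :: "real \<Rightarrow> real \<Rightarrow> real" where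
  "F_min D \<sigma> =
     1 - (1 + 2 / \<sigma>\<^sup>2) * (2 * exp (- (D\<^sup>2 / \<sigma>\<^sup>2)) / (1 - exp (- (D\<^sup>2 / \<sigma>\<^sup>2))))"

definition eta_small :: "nat \<Rightarrow> real \<Rightarrow> real \<Rightarrow> real \<Rightarrow> real \<Rightarrow> real \<Rightarrow> bool" where
  "eta_small k D \<sigma> f0 f1 \<eta> \<longleftrightarrow>
     \<eta> \<le> min
       (8 * F_min D \<sigma> /
         (34 * (2 * real k + 2) *
          sqrt (80 * real k + 8 + real k * P_const \<sigma> * (2 / (1 - exp (- (D\<^sup>2 / \<sigma>\<^sup>2)))))))
       (C_bar f0 f1 powr (1 / 6) / (4 * real k + 4 + 4 * real k / \<sigma>\<^sup>2) powr (1 / 3))"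

definition F_1 :: "nat \<Rightarrow> real \<Rightarrow> real \<Rightarrow> real \<Rightarrow> real \<Rightarrow> real \<Rightarrow> real \<Rightarrow> real" where
  "F_1 k D \<sigma> \<eta> fbar f0 f1 =
     ((6 + 2 / fbar) * sqrt (4 * real k + 5 + 4 * real k / \<sigma> ^ 4) * C_bar f0 f1 powr (5 / 4)
       + 6 / \<eta> * (C_bar f0 f1 + 2 * real k) powr (3 / 2))
     * (sqrt (2 * real k + 2) / (1 - sqrt (exp 1) / 2))
     * (F_max D \<sigma> / (F_min D \<sigma>)\<^sup>2) ^ k"

definition C_1 :: "nat \<Rightarrow> real \<Rightarrow> real \<Rightarrow> real \<Rightarrow> real" where
  "C_1 k fbar f0 f1 = (C_bar f0 f1 + 2 * real k) powr (3 / 2) / fbar"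

end

theory Submission
  imports Defs
begin

text \<open>
  The threshold \<open>f0_star\<close> may depend on the support, the samples, the width and \<open>\<epsilon>\<close>, and the factor
  \<open>F_1\<close> grows without bound with \<open>f0\<close>, uniformly over the admissible \<open>\<eta>\<close>: the conditions force
  \<open>\<eta> \<le> \<sigma>\<^sup>2 \<le> 2\<close>, so \<open>F_1 \<ge> 3 * f0 * G\<close> with some \<open>G > 0\<close> that is determined by \<open>k\<close>, \<open>\<sigma>\<close> and the
  separation (\<open>F_1_lower_bound\<close>). The first claim therefore follows from a stability estimate
  \<open>d_GW x xhat \<le> C * \<delta> + \<epsilon> * \<parallel>x\<parallel>\<close> in which \<open>C\<close> is some constant independent of the amplitudes,
  of the noise and of the solution (\<open>gauss_stability\<close>).

  That estimate is proved by duality. The moments of \<open>x\<close> and of \<open>xhat\<close> differ by at most \<open>2 * \<delta>\<close>,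
  hence integrals of functions in the span of the windows differ by \<open>O(\<delta>)\<close>. Three kinds of functions
  in the span suffice (\<open>stability_from_dual_functions\<close>): a non-negative \<open>q\<close> that vanishes exactly on the
  support bounds the mass of \<open>xhat\<close> away from the support; functions \<open>p i\<close> equal to 1 at \<open>t i\<close> and to 0
  at the other support points determine the mass of \<open>xhat\<close> near \<open>t i\<close> up to an error that is small
  when the neighbourhoods are small; a strictly positive function, a single window, bounds the total
  mass of \<open>xhat\<close>. Discarding the far mass and moving the mass near each \<open>t i\<close> onto \<open>t i\<close> is an
  admissible competitor in the definition of \<open>d_GW\<close> (\<open>d_GW_discrete_le\<close>).

  The certificates exist because Gaussian windows of one width are, up to a common factor,
  exponentials with distinct rates. By Rolle's theorem a non-trivial sum of \<open>n\<close> such exponentials has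
  fewer than \<open>n\<close> zeros. Linear algebra yields a sum of \<open>2 * k + 1\<close> exponentials with double zeros at
  the \<open>k\<close> support points; the zero count then leaves room neither for a further zero nor for a triple
  one, so the sum touches 0 without changing sign (\<open>exp_sum_nonneg_double_zeros\<close>).

  The second claim is elementary: the separation makes \<open>exp (- (\<Delta>\<^sup>2 / \<sigma>\<^sup>2))\<close> smaller than \<open>\<sigma>\<^sup>2 / 5\<close>,
  which bounds \<open>F_min\<close> below by a multiple of \<open>1 - 3 * \<sigma>\<^sup>2\<close> and \<open>F_max\<close> above by a multiple of
  \<open>1 / \<sigma> ^ 6\<close>.
\<close>

section \<open>Zeros of exponential sums\<close>

text \<open>
  Each gap between consecutive zeros contributes one zero of the derivative. The new zeros avoid the
  old ones, so that zeros of the derivative at double zeros of the function can be counted on top.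
  The last clause keeps them below the largest old zero, which is what the induction over the
  zeros in increasing order needs.
\<close>

lemma Rolle_zeros_between:
  fixes F g :: "real \<Rightarrow> real"
  assumes "finite A" "A \<noteq> {}" "\<And>x. (F has_real_derivative g x) (at x)" "\<And>x. x \<in> A \<Longrightarrow> F x = 0"
  shows "\<exists>Z. finite Z \<and> Suc (card Z) = card A \<and> Z \<inter> A = {} \<and> (\<forall>x\<in>Z. g x = 0 \<and> (\<exists>u\<in>A. x < u))"
  using assms(1,2,4)
proof (induction A rule: finite_linorder_max_induct)
  case empty
  then show ?case by simp
next
  case (insert v A)
  show ?case
  proof (cases "A = {}")
    case True
    then show ?thesis by (intro exI[of _ "{}"]) auto
  next
    case False
    obtain Z where Z: "finite Z" "Suc (card Z) = card A" "Z \<inter> A = {}"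
        "\<And>x. x \<in> Z \<Longrightarrow> g x = 0" "\<And>x. x \<in> Z \<Longrightarrow> \<exists>u\<in>A. x < u"
      using insert.IH[OF False] insert.prems by auto
    define u where "u = Max A"
    have u: "u \<in> A" and uA: "\<And>x. x \<in> A \<Longrightarrow> x \<le> u"
      unfolding u_def using insert.hyps(1) False by auto
    have "u < v" using insert.hyps(2) u by auto
    have "\<exists>z. u < z \<and> z < v \<and> DERIV F z :> 0"
    proof (rule Rolle[OF \<open>u < v\<close>])
      show "F u = F v" using u insert.prems by auto
      show "continuous_on {u..v} F"
        by (meson assms(3) DERIV_isCont continuous_at_imp_continuous_on)
      show "\<And>x. F differentiable (at x)"
        using assms(3) real_differentiable_def by blast
    qed
    then obtain z where z: "u < z" "z < v" "DERIV F z :> 0" by blast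
    have "g z = 0" using assms(3) z(3) DERIV_unique by blast
    have "z \<notin> A" using uA z(1) by force
    have "z \<notin> Z" using Z(5) uA z(1) by force
    have vZ: "v \<notin> Z" using Z(5) insert.hyps(2) by force
    show ?thesis
    proof (intro exI[of _ "insert z Z"] conjI ballI)
      show "Suc (card (insert z Z)) = card (insert v A)"
        using Z(1,2) \<open>z \<notin> Z\<close> insert.hyps by (auto simp: card_insert_if)
      show "insert z Z \<inter> insert v A = {}"
        using Z(3) \<open>z \<notin> A\<close> vZ z(2) by auto
    qed (use Z z \<open>g z = 0\<close> in auto)
  qed
qed

definition exp_sum :: "'a set \<Rightarrow> ('a \<Rightarrow> real) \<Rightarrow> ('a \<Rightarrow> real) \<Rightarrow> real \<Rightarrow> real" where
  "exp_sum J \<mu> b x = (\<Sum>j\<in>J. b j * exp (\<mu> j * x))"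

lemma exp_sum_deriv:
  "(exp_sum J \<mu> b has_real_derivative exp_sum J \<mu> (\<lambda>j. b j * \<mu> j) x) (at x)"
  unfolding exp_sum_def by (auto intro!: derivative_eq_intros sum.cong)

lemma exp_sum_cont: "continuous_on A (exp_sum J \<mu> b)"
  unfolding exp_sum_def by (intro continuous_intros)

lemma exp_sum_shift:
  "exp (- (c * x)) * exp_sum J \<mu> b x = exp_sum J (\<lambda>j. \<mu> j - c) b x"
  unfolding exp_sum_def by (simp add: sum_distrib_left exp_diff exp_minus left_diff_distrib field_simps)

text \<open>
  Subtracting the rate of one term from all rates turns this term into a constant, and
  differentiation removes it: this is the step that lowers the number of terms in every zero count
  below. Factoring out an exponential does not change the zeros.
\<close>

lemma exp_sum_shift_deriv:
  assumes "finite J" "p \<in> J"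
  shows "((\<lambda>x. exp_sum J (\<lambda>j. \<mu> j - \<mu> p) b x) has_real_derivative
     exp_sum (J - {p}) (\<lambda>j. \<mu> j - \<mu> p) (\<lambda>j. b j * (\<mu> j - \<mu> p)) x) (at x)"
proof -
  have "exp_sum (J - {p}) (\<lambda>j. \<mu> j - \<mu> p) (\<lambda>j. b j * (\<mu> j - \<mu> p)) x
      = exp_sum J (\<lambda>j. \<mu> j - \<mu> p) (\<lambda>j. b j * (\<mu> j - \<mu> p)) x"
    unfolding exp_sum_def using assms by (intro sum.mono_neutral_left) auto
  then show ?thesis using exp_sum_deriv by metis
qed

lemma exp_sum_linear: "exp_sum J \<mu> (\<lambda>j. b j * (\<mu> j - c)) x = exp_sum J \<mu> (\<lambda>j. b j * \<mu> j) x - c * exp_sum J \<mu> b x"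
  unfolding exp_sum_def by (simp add: sum_distrib_left sum_subtractf algebra_simps)

lemma exp_sum_shift_zero: "exp_sum J (\<lambda>j. \<mu> j - c) b x = 0 \<longleftrightarrow> exp_sum J \<mu> b x = 0"
  by (simp flip: exp_sum_shift)

text \<open>
  The sum with a single remaining term has no zeros.
\<close>

lemma exp_sum_pivot:
  assumes "finite J" "p \<in> J" "\<And>j. j \<in> J - {p} \<Longrightarrow> b j = 0" "exp_sum J \<mu> b x = 0"
  shows "\<forall>j\<in>J. b j = 0"
proof -
  have "exp_sum J \<mu> b x = b p * exp (\<mu> p * x)"
    unfolding exp_sum_def using assms(1-3) by (subst sum.remove[of J p]) auto
  then show ?thesis using assms by auto
qed

text \<open>
  Rolle's theorem loses one zero, and differentiation after a shift of the rates loses one term, so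
  the count follows by induction on the number of terms. It says that exponentials with distinct
  rates form a Chebyshev system on the real line.
\<close>

lemma exp_sum_zeros:
  assumes "finite J" "inj_on \<mu> J" "finite A" "card J \<le> card A" "\<And>x. x \<in> A \<Longrightarrow> exp_sum J \<mu> b x = 0"
  shows "\<forall>j\<in>J. b j = 0"
  using assms
proof (induction "card J" arbitrary: J \<mu> b A)
  case 0
  then show ?case by auto
next
  case (Suc n)
  then obtain p where p: "p \<in> J" by fastforce
  have "A \<noteq> {}" using Suc.hyps(2) Suc.prems(4) by auto
  obtain Z where Z: "finite Z" "Suc (card Z) = card A"
     "\<And>x. x \<in> Z \<Longrightarrow> exp_sum (J - {p}) (\<lambda>j. \<mu> j - \<mu> p) (\<lambda>j. b j * (\<mu> j - \<mu> p)) x = 0"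
    using Rolle_zeros_between[OF Suc.prems(3) \<open>A \<noteq> {}\<close> exp_sum_shift_deriv[OF Suc.prems(1) p, of \<mu> b]]
      Suc.prems(5) unfolding exp_sum_shift_zero by blast
  have "\<forall>j\<in>J - {p}. b j * (\<mu> j - \<mu> p) = 0"
  proof (rule Suc.hyps(1))
    show "n = card (J - {p})" using Suc.hyps(2) Suc.prems(1) p by simp
    show "inj_on (\<lambda>j. \<mu> j - \<mu> p) (J - {p})" using Suc.prems(2) by (auto simp: inj_on_def)
    show "card (J - {p}) \<le> card Z" using Suc.prems(1,4) Z(2) p by simp
  qed (use Suc.prems Z in auto)
  then have "\<And>j. j \<in> J - {p} \<Longrightarrow> b j = 0"
    using Suc.prems(2) p by (auto simp: inj_on_def)
  then show ?case using exp_sum_pivot[OF Suc.prems(1) p] Suc.prems(5) \<open>A \<noteq> {}\<close> by blast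
qed

text \<open>
  One step of the zero count with multiplicities: the points of \<open>B\<close>, where the sum vanishes to second
  order, remain zeros after differentiation and come in addition to the zeros from Rolle's theorem.
\<close>

lemma exp_sum_Rolle:
  assumes J: "finite J" "p \<in> J" and A: "finite A" "A \<noteq> {}" "B \<subseteq> A"
    and fA: "\<And>x. x \<in> A \<Longrightarrow> exp_sum J \<mu> b x = 0"
    and fB: "\<And>x. x \<in> B \<Longrightarrow> exp_sum J \<mu> (\<lambda>j. b j * \<mu> j) x = 0"
  obtains Z where "finite Z" "Suc (card Z) = card A + card B" "B \<subseteq> Z"
     "\<And>x. x \<in> Z \<Longrightarrow> exp_sum (J - {p}) (\<lambda>j. \<mu> j - \<mu> p) (\<lambda>j. b j * (\<mu> j - \<mu> p)) x = 0"
proof -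
  obtain Z where Z: "finite Z" "Suc (card Z) = card A" "Z \<inter> A = {}"
     "\<And>x. x \<in> Z \<Longrightarrow> exp_sum (J - {p}) (\<lambda>j. \<mu> j - \<mu> p) (\<lambda>j. b j * (\<mu> j - \<mu> p)) x = 0"
    using Rolle_zeros_between[OF A(1,2) exp_sum_shift_deriv[OF J, of \<mu> b]]
      fA unfolding exp_sum_shift_zero by blast
  have B: "exp_sum (J - {p}) (\<lambda>j. \<mu> j - \<mu> p) (\<lambda>j. b j * (\<mu> j - \<mu> p)) x = 0" if "x \<in> B" for x
  proof -
    have "exp_sum (J - {p}) (\<lambda>j. \<mu> j - \<mu> p) (\<lambda>j. b j * (\<mu> j - \<mu> p)) x
       = exp_sum J (\<lambda>j. \<mu> j - \<mu> p) (\<lambda>j. b j * (\<mu> j - \<mu> p)) x"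
      unfolding exp_sum_def using J by (intro sum.mono_neutral_left) auto
    also have "\<dots> = exp (- (\<mu> p * x)) * exp_sum J \<mu> (\<lambda>j. b j * (\<mu> j - \<mu> p)) x"
      by (simp only: exp_sum_shift)
    also have "\<dots> = 0" using fA[of x] fB[OF that] that A(3) by (auto simp: exp_sum_linear)
    finally show ?thesis .
  qed
  have "finite B" using A finite_subset by blast
  moreover from this have "card (Z \<union> B) = card Z + card B"
    using Z A by (intro card_Un_disjoint) auto
  ultimately show thesis using that[of "Z \<union> B"] Z A B by auto
qed

lemma exp_sum_double_zeros:
  assumes "finite J" "inj_on \<mu> J" "finite A" "B \<subseteq> A" "card J \<le> card A + card B"
    "\<And>x. x \<in> A \<Longrightarrow> exp_sum J \<mu> b x = 0" "\<And>x. x \<in> B \<Longrightarrow> exp_sum J \<mu> (\<lambda>j. b j * \<mu> j) x = 0"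
  shows "\<forall>j\<in>J. b j = 0"
proof (cases "J = {}")
  case False
  then obtain p where p: "p \<in> J" by blast
  have "A \<noteq> {}" using False assms by auto
  obtain Z where Z: "finite Z" "Suc (card Z) = card A + card B" "B \<subseteq> Z"
     "\<And>x. x \<in> Z \<Longrightarrow> exp_sum (J - {p}) (\<lambda>j. \<mu> j - \<mu> p) (\<lambda>j. b j * (\<mu> j - \<mu> p)) x = 0"
    using exp_sum_Rolle[OF assms(1) p assms(3) \<open>A \<noteq> {}\<close> assms(4,6,7)] by blast
  have "\<forall>j\<in>J - {p}. b j * (\<mu> j - \<mu> p) = 0"
  proof (rule exp_sum_zeros)
    show "inj_on (\<lambda>j. \<mu> j - \<mu> p) (J - {p})" using assms(2) by (auto simp: inj_on_def)
    show "card (J - {p}) \<le> card Z" using assms(1,5) Z(2) p by simp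
  qed (use assms Z in auto)
  then have "\<And>j. j \<in> J - {p} \<Longrightarrow> b j = 0"
    using assms(2) p by (auto simp: inj_on_def)
  then show ?thesis using exp_sum_pivot[OF assms(1) p] assms(6) \<open>A \<noteq> {}\<close> by blast
qed auto

text \<open>
  After one Rolle step, the derivative has a double zero at \<open>c\<close>, and the count with double zeros
  applies to it.
\<close>

lemma exp_sum_triple_zero:
  assumes "finite J" "inj_on \<mu> J" "finite A" "card J \<le> Suc (2 * card A)" "c \<in> A"
    "\<And>x. x \<in> A \<Longrightarrow> exp_sum J \<mu> b x = 0" "\<And>x. x \<in> A \<Longrightarrow> exp_sum J \<mu> (\<lambda>j. b j * \<mu> j) x = 0"
    "exp_sum J \<mu> (\<lambda>j. b j * \<mu> j * \<mu> j) c = 0"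
  shows "\<forall>j\<in>J. b j = 0"
proof (cases "J = {}")
  case False
  then obtain p where p: "p \<in> J" by blast
  have "A \<noteq> {}" using assms by auto
  obtain Z where Z: "finite Z" "Suc (card Z) = card A + card A" "A \<subseteq> Z"
     "\<And>x. x \<in> Z \<Longrightarrow> exp_sum (J - {p}) (\<lambda>j. \<mu> j - \<mu> p) (\<lambda>j. b j * (\<mu> j - \<mu> p)) x = 0"
    using exp_sum_Rolle[OF assms(1) p assms(3) \<open>A \<noteq> {}\<close> subset_refl assms(6,7)] by blast
  have c: "exp_sum (J - {p}) (\<lambda>j. \<mu> j - \<mu> p) (\<lambda>j. b j * (\<mu> j - \<mu> p) * (\<mu> j - \<mu> p)) c = 0"
  proof -
    have "exp_sum (J - {p}) (\<lambda>j. \<mu> j - \<mu> p) (\<lambda>j. b j * (\<mu> j - \<mu> p) * (\<mu> j - \<mu> p)) c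
      = exp_sum J (\<lambda>j. \<mu> j - \<mu> p) (\<lambda>j. b j * (\<mu> j - \<mu> p) * (\<mu> j - \<mu> p)) c"
      unfolding exp_sum_def using assms(1) p by (intro sum.mono_neutral_left) auto
    also have "\<dots> = exp (- (\<mu> p * c)) * exp_sum J \<mu> (\<lambda>j. b j * (\<mu> j - \<mu> p) * (\<mu> j - \<mu> p)) c"
      by (simp only: exp_sum_shift)
    also have "exp_sum J \<mu> (\<lambda>j. b j * (\<mu> j - \<mu> p) * (\<mu> j - \<mu> p)) c
       = exp_sum J \<mu> (\<lambda>j. b j * \<mu> j * \<mu> j) c - 2 * \<mu> p * exp_sum J \<mu> (\<lambda>j. b j * \<mu> j) c
         + \<mu> p * \<mu> p * exp_sum J \<mu> b c"
      unfolding exp_sum_def by (simp add: sum_distrib_left flip: sum_subtractf sum.distrib)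
        (simp add: algebra_simps)
    also have "\<dots> = 0" using assms(5-8) by simp
    finally show ?thesis by simp
  qed
  have "\<forall>j\<in>J - {p}. b j * (\<mu> j - \<mu> p) = 0"
  proof (rule exp_sum_double_zeros)
    show "inj_on (\<lambda>j. \<mu> j - \<mu> p) (J - {p})" using assms(2) by (auto simp: inj_on_def)
    show "card (J - {p}) \<le> card Z + card {c}" using assms(1,4) Z(2) p by simp
  qed (use assms Z c in auto)
  then have "\<And>j. j \<in> J - {p} \<Longrightarrow> b j = 0"
    using assms(2) p by (auto simp: inj_on_def)
  then show ?thesis using exp_sum_pivot[OF assms(1) p] assms(6) \<open>A \<noteq> {}\<close> by blast
qed auto

text \<open>
  Gaussian elimination of one equation together with one unknown.
\<close>

lemma underdetermined_system:
  fixes M :: "'e \<Rightarrow> 'a \<Rightarrow> real"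
  assumes "finite E" "finite J" "card E < card J"
  shows "\<exists>b. (\<exists>j\<in>J. b j \<noteq> 0) \<and> (\<forall>e\<in>E. (\<Sum>j\<in>J. b j * M e j) = 0)"
  using assms
proof (induction E arbitrary: J M rule: finite_induct)
  case empty
  then have "J \<noteq> {}" by auto
  then show ?case by (intro exI[of _ "\<lambda>_. 1"]) auto
next
  case (insert e E)
  show ?case
  proof (cases "\<forall>j\<in>J. M e j = 0")
    case True
    have "card E < card J" using insert.hyps insert.prems by simp
    from insert.IH[OF insert.prems(1) this, of M] obtain b where
      b: "\<exists>j\<in>J. b j \<noteq> 0" "\<forall>e'\<in>E. (\<Sum>j\<in>J. b j * M e' j) = 0" by blast
    have "(\<Sum>j\<in>J. b j * M e j) = 0" using True by (intro sum.neutral) simp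
    with b show ?thesis by blast
  next
    case False
    then obtain p where p: "p \<in> J" "M e p \<noteq> 0" by blast
    have "card E < card (J - {p})" using insert.hyps insert.prems p by simp
    have "finite (J - {p})" using insert.prems by simp
    from insert.IH[OF this \<open>card E < card (J - {p})\<close>, of "\<lambda>e' j. M e' j - M e' p * M e j / M e p"]
    obtain b where b: "\<exists>j\<in>J - {p}. b j \<noteq> 0"
      "\<And>e'. e' \<in> E \<Longrightarrow> (\<Sum>j\<in>J - {p}. b j * (M e' j - M e' p * M e j / M e p)) = 0" by blast
    define R where "R = (\<Sum>j\<in>J - {p}. b j * M e j)"
    define b' where "b' = b(p := - R / M e p)"
    have eq: "(\<Sum>j\<in>J. b' j * M e' j) = (\<Sum>j\<in>J - {p}. b j * M e' j) - R * M e' p / M e p" for e'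
    proof -
      have "(\<Sum>j\<in>J. b' j * M e' j) = b' p * M e' p + (\<Sum>j\<in>J - {p}. b' j * M e' j)"
        using p insert.prems by (subst sum.remove[of J p]) auto
      also have "(\<Sum>j\<in>J - {p}. b' j * M e' j) = (\<Sum>j\<in>J - {p}. b j * M e' j)"
        by (intro sum.cong) (auto simp: b'_def)
      finally show ?thesis by (simp add: b'_def)
    qed
    have "(\<Sum>j\<in>J. b' j * M e' j) = 0" if "e' \<in> insert e E" for e'
    proof (cases "e' = e")
      case True
      then show ?thesis using p unfolding eq R_def by simp
    next
      case False
      then have "(\<Sum>j\<in>J - {p}. b j * (M e' j - M e' p * M e j / M e p)) = 0" using that b(2) by simp
      moreover have "(\<Sum>j\<in>J - {p}. b j * (M e' j - M e' p * M e j / M e p))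
          = (\<Sum>j\<in>J - {p}. b j * M e' j) - R * M e' p / M e p"
        unfolding R_def
        by (simp add: right_diff_distrib sum_subtractf sum_distrib_left sum_distrib_right sum_divide_distrib mult_ac)
      ultimately show ?thesis unfolding eq by simp
    qed
    moreover have "\<exists>j\<in>J. b' j \<noteq> 0" using b(1) by (auto simp: b'_def)
    ultimately show ?thesis by blast
  qed
qed

text \<open>
  Solve for a sum that vanishes at all nodes but \<open>c\<close>. It cannot vanish at \<open>c\<close> as well, since it would
  then have too many zeros, and can be normalised there.
\<close>

lemma exp_sum_interpolation:
  assumes "finite J" "inj_on \<mu> J" "finite T" "card T \<le> card J" "c \<in> T"
  shows "\<exists>b. \<forall>x\<in>T. exp_sum J \<mu> b x = (if x = c then 1 else 0)"
proof -
  obtain J' where J': "J' \<subseteq> J" "card J' = card T" "finite J'"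
    using obtain_subset_with_card_n[OF assms(4)] by metis
  have "card (T - {c}) < card J'" using assms J' card_gt_0_iff[of T] by auto
  from underdetermined_system[OF _ _ this, of "\<lambda>x j. exp (\<mu> j * x)"] assms J'
  obtain b where b: "\<exists>j\<in>J'. b j \<noteq> 0" "\<forall>x\<in>T - {c}. exp_sum J' \<mu> b x = 0"
    unfolding exp_sum_def by auto
  have nz: "exp_sum J' \<mu> b c \<noteq> 0"
  proof
    assume "exp_sum J' \<mu> b c = 0"
    then have "\<forall>j\<in>J'. b j = 0"
      using b(2) assms J' by (intro exp_sum_zeros[of J' \<mu> T]) (auto intro: inj_on_subset)
    then show False using b(1) by blast
  qed
  define b' where "b' j = (if j \<in> J' then b j / exp_sum J' \<mu> b c else 0)" for j
  have "exp_sum J \<mu> b' x = exp_sum J' \<mu> b x / exp_sum J' \<mu> b c" for x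
  proof -
    have "exp_sum J \<mu> b' x = exp_sum J' \<mu> b' x"
      unfolding exp_sum_def using assms(1) J'(1) by (intro sum.mono_neutral_right) (auto simp: b'_def)
    also have "\<dots> = exp_sum J' \<mu> b x / exp_sum J' \<mu> b c"
      unfolding exp_sum_def[of _ _ _ x] by (auto simp: sum_divide_distrib b'_def intro!: sum.cong)
    finally show ?thesis .
  qed
  then show ?thesis using b(2) nz by (intro exI[of _ b']) auto
qed

lemma strict_local_min_second_derivative:
  fixes f f1 :: "real \<Rightarrow> real"
  assumes f: "\<And>x. (f has_real_derivative f1 x) (at x)" and f1: "(f1 has_real_derivative l) (at c)"
    and "f1 c = 0" "0 < l"
  shows "\<exists>d>0. \<forall>x. x \<noteq> c \<longrightarrow> \<bar>x - c\<bar> < d \<longrightarrow> f c < f x"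
proof -
  obtain d1 where d1: "d1 > 0" "\<And>h. 0 < h \<Longrightarrow> h < d1 \<Longrightarrow> 0 < f1 (c + h)"
    using DERIV_pos_inc_right[OF f1 \<open>0 < l\<close>] \<open>f1 c = 0\<close> by auto
  obtain d2 where d2: "d2 > 0" "\<And>h. 0 < h \<Longrightarrow> h < d2 \<Longrightarrow> f1 (c - h) < 0"
    using DERIV_pos_inc_left[OF f1 \<open>0 < l\<close>] \<open>f1 c = 0\<close> by auto
  have "f c < f x" if x: "x \<noteq> c" "\<bar>x - c\<bar> < min d1 d2" for x
  proof (cases "c < x")
    case True
    then obtain z where z: "c < z" "z < x" "f x - f c = (x - c) * f1 z"
      using MVT2[OF True, of f f1] f by blast
    have "0 < f1 z" using d1(2)[of "z - c"] z x by auto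
    then show ?thesis using z True by (smt (verit) mult_pos_pos)
  next
    case False
    then have "x < c" using x by simp
    then obtain z where z: "x < z" "z < c" "f c - f x = (c - x) * f1 z"
      using MVT2[OF \<open>x < c\<close>, of f f1] f by blast
    have "f1 z < 0" using d2(2)[of "c - z"] z x by auto
    then show ?thesis using z \<open>x < c\<close> by (smt (verit) mult_pos_neg)
  qed
  then show ?thesis using d1(1) d2(1) by (intro exI[of _ "min d1 d2"]) auto
qed

lemma exp_sum_cmult: "exp_sum J \<mu> (\<lambda>j. r * b j) x = r * exp_sum J \<mu> b x"
  unfolding exp_sum_def by (simp add: sum_distrib_left mult_ac)

text \<open>
  Prescribing double zeros at the \<open>k\<close> points of \<open>T\<close> imposes \<open>2 * k\<close> equations on \<open>2 * k + 1\<close> unknowns. A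
  non-trivial solution has no zero off \<open>T\<close> and non-zero second derivative on \<open>T\<close>, by the zero counts.
  The points around which the sum is positive except possibly at the point itself form an open set,
  so do those around which it is negative, and these two disjoint sets cover the connected real line.
\<close>

lemma exp_sum_nonneg_double_zeros:
  assumes J: "finite J" "inj_on \<mu> J" and T: "finite T" and card: "card J = 2 * card T + 1"
  shows "\<exists>b. \<forall>x. 0 \<le> exp_sum J \<mu> b x \<and> (exp_sum J \<mu> b x = 0 \<longleftrightarrow> x \<in> T)"
proof -
  have "card (T \<times> {0::nat, 1}) < card J" using card by (simp add: card_cartesian_product)
  from underdetermined_system[OF _ J(1) this, of "\<lambda>(x, d) j. \<mu> j ^ d * exp (\<mu> j * x)"] T
  obtain b where nz: "\<exists>j\<in>J. b j \<noteq> 0" and b: "\<And>x. x \<in> T \<Longrightarrow> exp_sum J \<mu> b x = 0"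
      "\<And>x. x \<in> T \<Longrightarrow> exp_sum J \<mu> (\<lambda>j. b j * \<mu> j) x = 0"
    unfolding exp_sum_def by (auto simp: mult.assoc)
  have off: "exp_sum J \<mu> b x \<noteq> 0" if "x \<notin> T" for x
  proof
    assume "exp_sum J \<mu> b x = 0"
    then have "\<forall>j\<in>J. b j = 0"
      using T card that b by (intro exp_sum_double_zeros[OF J, of "insert x T" T]) auto
    with nz show False by blast
  qed
  have curv: "exp_sum J \<mu> (\<lambda>j. b j * \<mu> j * \<mu> j) x \<noteq> 0" if "x \<in> T" for x
    using exp_sum_triple_zero[OF J T _ that b] card nz by auto
  (* for r = 1 the set where the sum is positive up to isolated zeros, for r = -1 where it is negative *)
  define U where "U r = {x. 0 < exp_sum J \<mu> (\<lambda>j. r * b j) x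
      \<or> x \<in> T \<and> 0 < exp_sum J \<mu> (\<lambda>j. r * b j * \<mu> j * \<mu> j) x}" for r :: real
  have "open (U r)" for r
  proof -
    let ?f = "exp_sum J \<mu> (\<lambda>j. r * b j)"
    have op: "open {x. 0 < ?f x}"
      by (intro open_Collect_less continuous_intros exp_sum_cont)
    have "\<exists>e>0. \<forall>y. dist y x < e \<longrightarrow> y \<in> U r" if "x \<in> U r" for x
    proof (cases "0 < ?f x")
      case True
      then obtain e where "e > 0" "\<forall>y. dist y x < e \<longrightarrow> 0 < ?f y" using op unfolding open_dist by blast
      then show ?thesis unfolding U_def by blast
    next
      case False
      then have x: "x \<in> T" "0 < exp_sum J \<mu> (\<lambda>j. r * b j * \<mu> j * \<mu> j) x"
        using that unfolding U_def by auto
      have z: "?f x = 0" "exp_sum J \<mu> (\<lambda>j. r * b j * \<mu> j) x = 0"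
        using b[OF x(1)] exp_sum_cmult[of J \<mu> r] by (simp_all add: mult.assoc)
      obtain d where d: "d > 0" "\<And>y. y \<noteq> x \<Longrightarrow> \<bar>y - x\<bar> < d \<Longrightarrow> ?f x < ?f y"
        using strict_local_min_second_derivative[OF exp_sum_deriv exp_sum_deriv z(2) x(2)] by blast
      have "y \<in> U r" if "dist y x < d" for y
        using d(2)[of y] that z \<open>x \<in> U r\<close> unfolding U_def dist_real_def by (cases "y = x") auto
      then show ?thesis using d(1) by blast
    qed
    then show ?thesis unfolding open_dist by blast
  qed
  moreover have "U 1 \<inter> U (-1) = {}"
    using exp_sum_cmult[of J \<mu> "-1"] b by (auto simp: U_def mult.assoc)
  moreover have "UNIV \<subseteq> U 1 \<union> U (-1)"
  proof
    fix x
    show "x \<in> U 1 \<union> U (-1)"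
      using exp_sum_cmult[of J \<mu> "-1"] off[of x] curv[of x]
      by (cases "x \<in> T") (auto simp: U_def mult.assoc)
  qed
  ultimately have "U 1 = {} \<or> U (-1) = {}"
    using connectedD[OF connected_UNIV, of "U 1" "U (-1)"] by simp
  then obtain r :: real where r: "r = 1 \<or> r = -1" "U r = {}" by blast
  have "0 \<le> exp_sum J \<mu> (\<lambda>j. - r * b j) x" for x
  proof -
    have "\<not> 0 < exp_sum J \<mu> (\<lambda>j. r * b j) x" using r(2) unfolding U_def by blast
    then show ?thesis unfolding exp_sum_cmult by simp
  qed
  moreover have "exp_sum J \<mu> (\<lambda>j. - r * b j) x = 0 \<longleftrightarrow> x \<in> T" for x
    using off b r(1) unfolding exp_sum_cmult by auto
  ultimately show ?thesis by blast
qed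

section \<open>Dual certificates in the span of the Gaussian windows\<close>

text \<open>
  Expanding the square in the exponent: the windows are exponentials with rates \<open>2 * s j / \<sigma>\<^sup>2\<close>, up to
  constants and a common positive factor.
\<close>

lemma gauss_span_exp_sum:
  "(\<Sum>j\<in>J. (b j * exp ((s j)\<^sup>2 / \<sigma>\<^sup>2)) * gauss_window \<sigma> s j x)
     = exp (- (x\<^sup>2 / \<sigma>\<^sup>2)) * exp_sum J (\<lambda>j. 2 * s j / \<sigma>\<^sup>2) b x"
proof -
  have "exp ((s j)\<^sup>2 / \<sigma>\<^sup>2) * gauss_window \<sigma> s j x = exp (- (x\<^sup>2 / \<sigma>\<^sup>2)) * exp (2 * s j / \<sigma>\<^sup>2 * x)" for j
  proof -
    have "(s j)\<^sup>2 / \<sigma>\<^sup>2 + - ((x - s j)\<^sup>2 / \<sigma>\<^sup>2) = - (x\<^sup>2 / \<sigma>\<^sup>2) + 2 * s j / \<sigma>\<^sup>2 * x"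
      by (simp add: power2_diff diff_divide_distrib add_divide_distrib)
    then show ?thesis unfolding gauss_window_def by (metis exp_add)
  qed
  then show ?thesis
    unfolding exp_sum_def sum_distrib_left by (intro sum.cong) (auto simp: mult_ac)
qed

lemma gauss_exponents_inj:
  fixes s :: "nat \<Rightarrow> real"
  assumes "strict_mono_on M s" "\<sigma> > 0"
  shows "inj_on (\<lambda>j. 2 * s j / \<sigma>\<^sup>2) M"
  using strict_mono_on_imp_inj_on[OF assms(1)] assms(2) by (auto simp: inj_on_def)

lemma gauss_dual_polynomial:
  assumes "strict_mono_on {1..m} s" "\<sigma> > 0" "finite T" "2 * card T + 1 \<le> m"
  shows "\<exists>\<beta>. \<forall>x. 0 \<le> (\<Sum>j=1..m. \<beta> j * gauss_window \<sigma> s j x)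
                \<and> ((\<Sum>j=1..m. \<beta> j * gauss_window \<sigma> s j x) = 0 \<longleftrightarrow> x \<in> T)"
proof -
  define J where "J = {1..2 * card T + 1}"
  have J: "J \<subseteq> {1..m}" "finite J" "card J = 2 * card T + 1" using assms(4) by (auto simp: J_def)
  have "inj_on (\<lambda>j. 2 * s j / \<sigma>\<^sup>2) J"
    using gauss_exponents_inj[OF assms(1,2)] J(1) inj_on_subset by blast
  from exp_sum_nonneg_double_zeros[OF J(2) this assms(3) J(3)] obtain b where
    b: "\<And>x. 0 \<le> exp_sum J (\<lambda>j. 2 * s j / \<sigma>\<^sup>2) b x \<and> (exp_sum J (\<lambda>j. 2 * s j / \<sigma>\<^sup>2) b x = 0 \<longleftrightarrow> x \<in> T)"
    by blast
  define \<beta> where "\<beta> j = (if j \<in> J then b j * exp ((s j)\<^sup>2 / \<sigma>\<^sup>2) else 0)" for j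
  have "(\<Sum>j=1..m. \<beta> j * gauss_window \<sigma> s j x)
      = exp (- (x\<^sup>2 / \<sigma>\<^sup>2)) * exp_sum J (\<lambda>j. 2 * s j / \<sigma>\<^sup>2) b x" for x
  proof -
    have "(\<Sum>j=1..m. \<beta> j * gauss_window \<sigma> s j x) = (\<Sum>j\<in>J. \<beta> j * gauss_window \<sigma> s j x)"
      using J(1) by (intro sum.mono_neutral_right) (auto simp: \<beta>_def)
    also have "\<dots> = (\<Sum>j\<in>J. (b j * exp ((s j)\<^sup>2 / \<sigma>\<^sup>2)) * gauss_window \<sigma> s j x)"
      by (intro sum.cong) (auto simp: \<beta>_def)
    finally show ?thesis unfolding gauss_span_exp_sum .
  qed
  then show ?thesis using b by (intro exI[of _ \<beta>]) auto
qed

lemma gauss_interpolation: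
  assumes "strict_mono_on {1..m} s" "\<sigma> > 0" "finite T" "card T \<le> m" "c \<in> T"
  shows "\<exists>\<beta>. \<forall>x\<in>T. (\<Sum>j=1..m. \<beta> j * gauss_window \<sigma> s j x) = (if x = c then 1 else 0)"
proof -
  let ?\<mu> = "\<lambda>j. 2 * s j / \<sigma>\<^sup>2"
  obtain b where b: "\<And>x. x \<in> T \<Longrightarrow> exp_sum {1..m} ?\<mu> b x = (if x = c then 1 else 0)"
    using exp_sum_interpolation[OF _ gauss_exponents_inj[OF assms(1,2)] assms(3) _ assms(5)] assms(4)
    by auto
  have "(\<Sum>j=1..m. ((exp (c\<^sup>2 / \<sigma>\<^sup>2) * b j) * exp ((s j)\<^sup>2 / \<sigma>\<^sup>2)) * gauss_window \<sigma> s j x)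
      = (if x = c then 1 else 0)" if "x \<in> T" for x
    unfolding gauss_span_exp_sum exp_sum_cmult b[OF that] by (simp add: mult_exp_exp)
  then show ?thesis
    by (intro exI[of _ "\<lambda>j. (exp (c\<^sup>2 / \<sigma>\<^sup>2) * b j) * exp ((s j)\<^sup>2 / \<sigma>\<^sup>2)"] ballI)
qed

section \<open>Total variation, couplings and the generalised Wasserstein distance\<close>

lemma space_nonneg: "z \<in> nonneg_measures \<Longrightarrow> space z = {0..1}"
  unfolding nonneg_measures_def using sets_eq_imp_space_eq[of z unit_borel] by auto

lemma sets_nonneg: "z \<in> nonneg_measures \<Longrightarrow> sets z = sets unit_borel"
  unfolding nonneg_measures_def by auto

lemma finite_nonneg: "z \<in> nonneg_measures \<Longrightarrow> finite_measure z"
  unfolding nonneg_measures_def by auto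

lemma unit_borel_interval: "{0..1} \<in> sets unit_borel"
  using sets.top[of unit_borel] by simp

text \<open>
  For a non-negative measure every partition attains the supremum that defines the total variation.
\<close>

lemma sum_measure_partition:
  assumes "z \<in> nonneg_measures" "finite P" "partition_on {0..1} P" "P \<subseteq> sets unit_borel"
  shows "(\<Sum>A\<in>P. measure z A) = measure z {0..1}"
proof -
  interpret finite_measure z using finite_nonneg[OF assms(1)] .
  have "(\<Sum>A\<in>P. measure z A) = measure z (\<Union>A\<in>P. A)"
    using assms partition_onD2[OF assms(3)]
    by (intro finite_measure_finite_Union[symmetric]) (auto simp: sets_nonneg disjoint_family_on_def disjoint_def)
  then show ?thesis using partition_onD1[OF assms(3)] by simp
qed

abbreviation borel_partitions :: "real set set set" where
  "borel_partitions \<equiv> {P. finite P \<and> partition_on {0..1} P \<and> P \<subseteq> sets unit_borel}"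

lemma trivial_partition: "{{0..1}} \<in> borel_partitions"
  using unit_borel_interval by (auto simp: partition_on_def disjoint_def)

lemma dominated_sum:
  assumes "\<nu> \<in> nonneg_measures" "\<And>A. A \<in> sets unit_borel \<Longrightarrow> \<bar>\<mu> A\<bar> \<le> measure \<nu> A"
    "P \<in> borel_partitions"
  shows "(\<Sum>A\<in>P. \<bar>\<mu> A\<bar>) \<le> measure \<nu> {0..1}"
proof -
  have "(\<Sum>A\<in>P. \<bar>\<mu> A\<bar>) \<le> (\<Sum>A\<in>P. measure \<nu> A)"
    using assms(2,3) by (intro sum_mono) auto
  then show ?thesis using sum_measure_partition[OF assms(1)] assms(3) by simp
qed

text \<open>
  In what follows, total variations are bounded by exhibiting a dominating non-negative measure.
\<close>

lemma tv_norm_le: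
  assumes "\<nu> \<in> nonneg_measures" "\<And>A. A \<in> sets unit_borel \<Longrightarrow> \<bar>\<mu> A\<bar> \<le> measure \<nu> A"
  shows "tv_norm \<mu> \<le> measure \<nu> {0..1}"
  unfolding tv_norm_def using trivial_partition dominated_sum[OF assms]
  by (intro cSUP_least) auto

lemma tv_norm_measure:
  assumes "z \<in> nonneg_measures"
  shows "tv_norm (measure z) = measure z {0..1}"
proof -
  have "tv_norm (measure z) = (SUP P\<in>borel_partitions. measure z {0..1})"
    unfolding tv_norm_def using sum_measure_partition[OF assms] by (intro SUP_cong) auto
  also have "\<dots> = measure z {0..1}" using trivial_partition by (intro cSUP_const) blast
  finally show ?thesis .
qed

text \<open>
  The supremum of a set of reals is meaningful only for bounded sets; the sums are bounded by the sum
  of the two masses.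
\<close>

lemma tv_norm_diff_nonneg:
  assumes "z1 \<in> nonneg_measures" "z2 \<in> nonneg_measures"
  shows "0 \<le> tv_norm (\<lambda>A. measure z1 A - measure z2 A)"
proof -
  let ?\<mu> = "\<lambda>A. measure z1 A - measure z2 A"
  have "bdd_above ((\<lambda>P. \<Sum>A\<in>P. \<bar>?\<mu> A\<bar>) ` borel_partitions)"
  proof (rule bdd_aboveI2)
    fix P assume P: "P \<in> borel_partitions"
    have "(\<Sum>A\<in>P. \<bar>?\<mu> A\<bar>) \<le> (\<Sum>A\<in>P. measure z1 A + measure z2 A)"
      by (intro sum_mono) (auto simp: abs_le_iff intro: add_increasing add_increasing2)
    also have "\<dots> = measure z1 {0..1} + measure z2 {0..1}"
      using P assms by (simp add: sum.distrib sum_measure_partition)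
    finally show "(\<Sum>A\<in>P. \<bar>?\<mu> A\<bar>) \<le> measure z1 {0..1} + measure z2 {0..1}" .
  qed
  from cSUP_upper[OF trivial_partition this] show ?thesis
    unfolding tv_norm_def by (smt (verit) sum_nonneg abs_ge_zero)
qed

lemma distr_pair_fst_unit:
  assumes "sets z1 = sets unit_borel" "sets z2 = sets unit_borel" "finite_measure z2"
  shows "A \<in> sets unit_borel \<Longrightarrow> emeasure (distr (z1 \<Otimes>\<^sub>M z2) unit_borel fst) A = emeasure z1 A * emeasure z2 {0..1}"
proof -
  interpret finite_measure z2 by fact
  assume A: "A \<in> sets unit_borel"
  have sp: "space z1 = {0..1}" "space z2 = {0..1}" using assms(1,2)[THEN sets_eq_imp_space_eq] by simp_all
  have m: "fst \<in> measurable (z1 \<Otimes>\<^sub>M z2) unit_borel"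
    using measurable_fst[of z1 z2] measurable_cong_sets[OF refl assms(1)] by blast
  have "A \<subseteq> {0..1}" using sets.sets_into_space[OF A] by auto
  then have "fst -` A \<inter> space (z1 \<Otimes>\<^sub>M z2) = A \<times> {0..1}" using sp by (auto simp: space_pair_measure)
  then show ?thesis using A assms m unit_borel_interval
    by (simp add: emeasure_distr emeasure_pair_measure_Times)
qed

lemma distr_pair_snd_unit:
  assumes "sets z1 = sets unit_borel" "sets z2 = sets unit_borel" "finite_measure z2"
  shows "A \<in> sets unit_borel \<Longrightarrow> emeasure (distr (z1 \<Otimes>\<^sub>M z2) unit_borel snd) A = emeasure z1 {0..1} * emeasure z2 A"
proof -
  interpret finite_measure z2 by fact
  assume A: "A \<in> sets unit_borel"
  have sp: "space z1 = {0..1}" "space z2 = {0..1}" using assms(1,2)[THEN sets_eq_imp_space_eq] by simp_all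
  have m: "snd \<in> measurable (z1 \<Otimes>\<^sub>M z2) unit_borel"
    using measurable_snd[of z1 z2] measurable_cong_sets[OF refl assms(2)] by blast
  have "A \<subseteq> {0..1}" using sets.sets_into_space[OF A] by auto
  then have "snd -` A \<inter> space (z1 \<Otimes>\<^sub>M z2) = {0..1} \<times> A" using sp by (auto simp: space_pair_measure)
  then show ?thesis using A assms m unit_borel_interval
    by (simp add: emeasure_distr emeasure_pair_measure_Times)
qed

text \<open>
  The normalised product measure is a coupling. Were there no coupling, \<open>d_W\<close> would be the infimum of
  the empty set, about which nothing is known, and the infimum defining \<open>d_GW\<close> could fail to be
  bounded below.
\<close>

lemma couplings_nonempty:
  assumes z: "z1 \<in> nonneg_measures" "z2 \<in> nonneg_measures"
    and mass: "measure z1 {0..1} = measure z2 {0..1}"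
  shows "couplings z1 z2 \<noteq> {}"
proof -
  interpret Z1: finite_measure z1 using finite_nonneg[OF z(1)] .
  interpret Z2: finite_measure z2 using finite_nonneg[OF z(2)] .
  note S1 = sets_nonneg[OF z(1)] and S2 = sets_nonneg[OF z(2)]
  define M where "M = measure z1 {0..1}"
  have e: "emeasure z1 {0..1} = ennreal M" "emeasure z2 {0..1} = ennreal M"
    unfolding M_def Z1.emeasure_eq_measure Z2.emeasure_eq_measure using mass by auto
  have M0: "M \<ge> 0" unfolding M_def by simp
  define \<gamma> where "\<gamma> = scale_measure (ennreal (1 / M)) (z1 \<Otimes>\<^sub>M z2)"
  have sg: "sets \<gamma> = sets (unit_borel \<Otimes>\<^sub>M unit_borel)"
    unfolding \<gamma>_def using S1 S2 by (simp cong: sets_pair_measure_cong)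
  have d: "distr \<gamma> unit_borel f = scale_measure (ennreal (1 / M)) (distr (z1 \<Otimes>\<^sub>M z2) unit_borel f)"
    if f: "f \<in> measurable (z1 \<Otimes>\<^sub>M z2) unit_borel" for f
  proof (rule measure_eqI)
    fix A assume "A \<in> sets (distr \<gamma> unit_borel f)"
    moreover have "f \<in> measurable \<gamma> unit_borel" using f unfolding \<gamma>_def by simp
    moreover have "space \<gamma> = space (z1 \<Otimes>\<^sub>M z2)" unfolding \<gamma>_def by (simp add: space_scale_measure)
    ultimately show "emeasure (distr \<gamma> unit_borel f) A
        = emeasure (scale_measure (ennreal (1 / M)) (distr (z1 \<Otimes>\<^sub>M z2) unit_borel f)) A"
      using f by (simp add: emeasure_distr \<gamma>_def)
  qed simp
  have scale: "ennreal (1 / M) * (emeasure z A * ennreal M) = emeasure z A"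
    if "z = z1 \<or> z = z2" "A \<in> sets unit_borel" for z A
  proof (cases "M = 0")
    case True
    have "A \<subseteq> {0..1}" using sets.sets_into_space[OF that(2)] by auto
    then have "emeasure z A \<le> emeasure z {0..1}"
      using that S1 S2 unit_borel_interval by (intro emeasure_mono) auto
    then show ?thesis using that e True by auto
  next
    case False
    then have "ennreal (1 / M) * ennreal M = 1" using M0 by (simp flip: ennreal_mult'')
    then show ?thesis by (metis mult.commute mult.left_commute mult_1_right)
  qed
  have f1: "fst \<in> measurable (z1 \<Otimes>\<^sub>M z2) unit_borel"
    using measurable_fst[of z1 z2] measurable_cong_sets[OF refl S1] by blast
  have f2: "snd \<in> measurable (z1 \<Otimes>\<^sub>M z2) unit_borel"
    using measurable_snd[of z1 z2] measurable_cong_sets[OF refl S2] by blast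
  have "distr \<gamma> unit_borel fst = z1"
    unfolding d[OF f1]
    by (rule measure_eqI)
      (use S1 S2 in \<open>auto simp: distr_pair_fst_unit[OF S1 S2 Z2.finite_measure_axioms] e scale\<close>)
  moreover have "distr \<gamma> unit_borel snd = z2"
    unfolding d[OF f2]
    by (rule measure_eqI)
      (use S1 S2 scale in \<open>auto simp: distr_pair_snd_unit[OF S1 S2 Z2.finite_measure_axioms] e mult.commute\<close>)
  ultimately show ?thesis using sg unfolding couplings_def by blast
qed

lemma d_W_le: "\<gamma> \<in> couplings z1 z2 \<Longrightarrow> d_W z1 z2 \<le> (\<integral>p. \<bar>fst p - snd p\<bar> \<partial>\<gamma>)"
  unfolding d_W_def by (intro cINF_lower bdd_belowI2[of _ 0]) auto

lemma d_W_nonneg: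
  assumes "z1 \<in> nonneg_measures" "z2 \<in> nonneg_measures" "measure z1 {0..1} = measure z2 {0..1}"
  shows "0 \<le> d_W z1 z2"
  unfolding d_W_def using couplings_nonempty[OF assms] by (intro cINF_greatest) auto

lemma d_GW_le:
  assumes x: "x1 \<in> nonneg_measures" "x2 \<in> nonneg_measures"
    and z: "z1 \<in> nonneg_measures" "z2 \<in> nonneg_measures" "\<gamma> \<in> couplings z1 z2"
    and mass: "measure z1 {0..1} = measure z2 {0..1}"
  shows "d_GW x1 x2 \<le> tv_norm (\<lambda>A. measure x1 A - measure z1 A)
     + (\<integral>p. \<bar>fst p - snd p\<bar> \<partial>\<gamma>) + tv_norm (\<lambda>A. measure x2 A - measure z2 A)"
proof -
  let ?Z = "{(z1, z2). z1 \<in> nonneg_measures \<and> z2 \<in> nonneg_measures \<and>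
                               tv_norm (measure z1) = tv_norm (measure z2)}"
  let ?c = "\<lambda>(z1, z2). tv_norm (\<lambda>A. measure x1 A - measure z1 A) + d_W z1 z2
          + tv_norm (\<lambda>A. measure x2 A - measure z2 A)"
  have "bdd_below (?c ` ?Z)"
  proof (rule bdd_belowI2)
    fix p assume "p \<in> ?Z"
    then obtain u v where p: "p = (u, v)" "u \<in> nonneg_measures" "v \<in> nonneg_measures"
      "measure u {0..1} = measure v {0..1}" by (auto simp: tv_norm_measure)
    then show "0 \<le> ?c p"
      using tv_norm_diff_nonneg x d_W_nonneg by (auto intro!: add_nonneg_nonneg)
  qed
  moreover have "(z1, z2) \<in> ?Z" using z mass by (simp add: tv_norm_measure)
  ultimately have "d_GW x1 x2 \<le> ?c (z1, z2)" unfolding d_GW_def by (rule cINF_lower)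
  then show ?thesis using d_W_le[OF z(3)] by simp
qed

text \<open>
  A push-forward of a weighted counting measure on the index set; this gives countable additivity and
  the integral formula for free.
\<close>

lemma discrete_measure_eq_distr:
  assumes "t ` {1..k} \<subseteq> {0..1}"
  shows "discrete_measure k a t = distr (point_measure {1..k} (\<lambda>i. ennreal (a i))) unit_borel t"
    (is "_ = ?D")
proof -
  have tm: "t \<in> measurable (point_measure {1..k} (\<lambda>i. ennreal (a i))) unit_borel"
    using assms by (auto simp: image_subset_iff)
  have "(\<Sum>i=1..k. ennreal (a i) * emeasure (return unit_borel (t i)) A) = emeasure ?D A"
    if A: "A \<in> sets unit_borel" for A
  proof -
    have "emeasure ?D A = (\<Sum>i\<in>t -` A \<inter> {1..k}. ennreal (a i))"
      using A tm by (simp add: emeasure_distr space_point_measure emeasure_point_measure_finite)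
    also have "\<dots> = (\<Sum>i=1..k. if i \<in> t -` A then ennreal (a i) else 0)"
      by (subst sum.inter_restrict[symmetric]) (auto intro!: sum.cong)
    also have "\<dots> = (\<Sum>i=1..k. ennreal (a i) * emeasure (return unit_borel (t i)) A)"
      using A by (intro sum.cong) (auto simp: emeasure_return)
    finally show ?thesis by simp
  qed
  then have "discrete_measure k a t = measure_of (space unit_borel) (sets unit_borel) (emeasure ?D)"
    unfolding discrete_measure_def by (intro measure_of_eq sets.space_closed) (simp only: sets.sigma_sets_eq)
  also have "\<dots> = ?D" using measure_of_of_measure[of ?D] by simp
  finally show ?thesis .
qed

context
  fixes k :: nat and a t :: "nat \<Rightarrow> real"
  assumes t: "t ` {1..k} \<subseteq> {0..1}" and a: "\<forall>i\<in>{1..k}. 0 \<le> a i"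
begin

lemma discrete_measure_nonneg: "discrete_measure k a t \<in> nonneg_measures"
proof -
  have "finite_measure (point_measure {1..k} (\<lambda>i. ennreal (a i)))"
    by (rule finite_measureI) (simp add: space_point_measure emeasure_point_measure_finite)
  then have "finite_measure (discrete_measure k a t)"
    unfolding discrete_measure_eq_distr[OF t] using t
    by (intro finite_measure.finite_measure_distr) auto
  then show ?thesis unfolding nonneg_measures_def discrete_measure_eq_distr[OF t] by simp
qed

lemma measure_discrete_measure:
  assumes "A \<in> sets unit_borel"
  shows "measure (discrete_measure k a t) A = (\<Sum>i=1..k. a i * indicator A (t i))"
proof -
  have "measure (discrete_measure k a t) A
      = measure (point_measure {1..k} (\<lambda>i. ennreal (a i))) (t -` A \<inter> {1..k})"
    unfolding discrete_measure_eq_distr[OF t] using assms t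
    by (subst measure_distr) (auto simp: space_point_measure)
  also have "\<dots> = (\<Sum>i\<in>{1..k} \<inter> t -` A. a i)"
  proof -
    have "(\<Sum>i\<in>{1..k} \<inter> t -` A. ennreal (a i)) = ennreal (\<Sum>i\<in>{1..k} \<inter> t -` A. a i)"
      using a by (intro sum_ennreal) auto
    moreover have "0 \<le> (\<Sum>i\<in>{1..k} \<inter> t -` A. a i)" using a by (intro sum_nonneg) auto
    ultimately show ?thesis
      unfolding measure_def Int_commute[of "t -` A"] by (simp add: emeasure_point_measure_finite)
  qed
  also have "\<dots> = (\<Sum>i=1..k. if i \<in> t -` A then a i else 0)"
    by (subst sum.inter_restrict) auto
  also have "\<dots> = (\<Sum>i=1..k. a i * indicator A (t i))" by (intro sum.cong) auto
  finally show ?thesis .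
qed

lemma mass_discrete_measure: "measure (discrete_measure k a t) {0..1} = (\<Sum>i=1..k. a i)"
  unfolding measure_discrete_measure[OF unit_borel_interval] using t by (intro sum.cong) (auto simp: image_subset_iff)

lemma integral_discrete_measure:
  fixes f :: "real \<Rightarrow> real"
  assumes "f \<in> borel_measurable unit_borel"
  shows "(\<integral>x. f x \<partial>discrete_measure k a t) = (\<Sum>i=1..k. a i * f (t i))"
proof -
  have "(\<integral>x. f x \<partial>discrete_measure k a t)
      = (\<integral>i. f (t i) \<partial>point_measure {1..k} (\<lambda>i. ennreal (a i)))"
    unfolding discrete_measure_eq_distr[OF t] using t assms
    by (subst integral_distr) (auto simp: image_subset_iff)
  also have "\<dots> = (\<Sum>i=1..k. a i *\<^sub>R f (t i))"
    using a by (intro lebesgue_integral_point_measure_finite) auto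
  finally show ?thesis by simp
qed

end

lemma continuous_borel_measurable_nonneg:
  fixes f :: "real \<Rightarrow> real"
  assumes "z \<in> nonneg_measures" "continuous_on {0..1} f"
  shows "f \<in> borel_measurable z"
  using borel_measurable_continuous_on_restrict[OF assms(2)]
    measurable_cong_sets[OF sets_nonneg[OF assms(1)] refl] by blast

lemma continuous_integrable_nonneg:
  fixes f :: "real \<Rightarrow> real"
  assumes "z \<in> nonneg_measures" "continuous_on {0..1} f"
  shows "integrable z f"
proof -
  have "bounded (f ` {0..1})"
    by (intro compact_imp_bounded compact_continuous_image assms(2)) simp
  then obtain B where "\<forall>y\<in>f ` {0..1}. norm y \<le> B" unfolding bounded_iff by blast
  then have "AE x in z. norm (f x) \<le> B" using space_nonneg[OF assms(1)] by (intro AE_I2) auto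
  then show ?thesis
    using finite_measure.integrable_const_bound[OF finite_nonneg[OF assms(1)]]
      continuous_borel_measurable_nonneg[OF assms] by blast
qed

text \<open>
  The competitor keeps the mass of \<open>z\<close> in the sets \<open>N i\<close>, discards the rest, and transports all mass in
  \<open>N i\<close> to the point \<open>t i\<close>, over a distance of at most \<open>\<rho>\<close>. The three terms are the mismatch of the
  resulting amplitudes, the transport cost, and the discarded mass.
\<close>

lemma d_GW_discrete_le:
  assumes t: "t ` {1..k} \<subseteq> {0..1}" and a: "\<forall>i\<in>{1..k}. 0 \<le> a i" and z: "z \<in> nonneg_measures"
    and N: "\<And>i. i \<in> {1..k} \<Longrightarrow> N i \<in> sets unit_borel" "disjoint_family_on N {1..k}"
    and \<rho>: "\<And>i x. i \<in> {1..k} \<Longrightarrow> x \<in> N i \<Longrightarrow> \<bar>x - t i\<bar> \<le> \<rho>" "0 \<le> \<rho>"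
  shows "d_GW (discrete_measure k a t) z
    \<le> (\<Sum>i=1..k. \<bar>a i - measure z (N i)\<bar>) + \<rho> * measure z {0..1} + measure z ({0..1} - (\<Union>i\<in>{1..k}. N i))"
proof -
  interpret finite_measure z using finite_nonneg[OF z] .
  note sz = sets_nonneg[OF z] and spz = space_nonneg[OF z]
  define U where "U = (\<Union>i\<in>{1..k}. N i)"
  have U: "U \<in> sets unit_borel" unfolding U_def using N by (intro sets.finite_UN) auto
  have restr: "density z (indicator V) \<in> nonneg_measures" if "V \<in> sets unit_borel" for V
    unfolding nonneg_measures_def using that sz finite_measure_restricted by simp
  have mrestr: "measure (density z (indicator V)) A = measure z (V \<inter> A)"
    if "V \<in> sets unit_borel" "A \<in> sets unit_borel" for V A
    using measure_restricted that sz by auto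
  (* the transport map: constant t i on N i, and 0 off all N i, where z2 below has no mass *)
  define r where "r x = (\<Sum>i=1..k. t i * indicator (N i) x)" for x
  have rN: "r x = t i" if "i \<in> {1..k}" "x \<in> N i" for i x
  proof -
    have "r x = (\<Sum>l=1..k. if l = i then t i else 0)"
      unfolding r_def
    proof (intro sum.cong refl)
      fix l assume "l \<in> {1..k}"
      then have "x \<in> N l \<longleftrightarrow> l = i" using that N(2) unfolding disjoint_family_on_def by blast
      then show "t l * indicator (N l) x = (if l = i then t i else 0)" by auto
    qed
    then show ?thesis using that by simp
  qed
  have r01: "r x \<in> {0..1}" for x
  proof (cases "x \<in> U")
    case True
    then obtain i where "i \<in> {1..k}" "x \<in> N i" unfolding U_def by blast
    then have "r x = t i" "t i \<in> {0..1}" using rN t by blast+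
    then show ?thesis by simp
  next
    case False
    then have "r x = 0" unfolding r_def U_def by (intro sum.neutral) auto
    then show ?thesis by simp
  qed
  have "r \<in> borel_measurable unit_borel" unfolding r_def using N(1) by measurable
  then have rm: "r \<in> measurable unit_borel unit_borel"
    using r01 by (intro measurable_restrict_space2) auto
  define z2 where "z2 = density z (indicator U)"
  have z2: "z2 \<in> nonneg_measures" unfolding z2_def using restr[OF U] .
  have rm2: "r \<in> measurable z2 unit_borel" "(\<lambda>x. x) \<in> measurable z2 unit_borel"
    using rm measurable_cong_sets[OF sets_nonneg[OF z2] refl]  measurable_ident_sets[OF sets_nonneg[OF z2]] by auto
  then have pm: "(\<lambda>x. (r x, x)) \<in> measurable z2 (unit_borel \<Otimes>\<^sub>M unit_borel)" by measurable
  define z1 where "z1 = distr z2 unit_borel r"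
  define \<gamma> where "\<gamma> = distr z2 (unit_borel \<Otimes>\<^sub>M unit_borel) (\<lambda>x. (r x, x))"
  have z1: "z1 \<in> nonneg_measures"
    unfolding z1_def nonneg_measures_def
    using finite_measure.finite_measure_distr[OF finite_nonneg[OF z2] rm2(1)] by simp
  have "distr z2 unit_borel (\<lambda>x. x) = z2"
    using sets_nonneg[OF z2] by (intro distr_id2) auto
  then have \<gamma>: "\<gamma> \<in> couplings z1 z2"
    unfolding couplings_def \<gamma>_def z1_def using pm by (simp add: distr_distr comp_def)
  have mz1: "measure z1 A = (\<Sum>i=1..k. measure z (N i) * indicator A (t i))"
    if A: "A \<in> sets unit_borel" for A
  proof -
    have rA: "r -` A \<inter> {0..1} \<in> sets unit_borel" using measurable_sets[OF rm A] by simp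
    have "N i \<subseteq> {0..1}" if "i \<in> {1..k}" for i using sets.sets_into_space[OF N(1)[OF that]] by simp
    then have eq: "U \<inter> (r -` A \<inter> {0..1}) = (\<Union>i\<in>{i \<in> {1..k}. t i \<in> A}. N i)"
      unfolding U_def using rN by auto
    have "measure z1 A = measure z (U \<inter> (r -` A \<inter> {0..1}))"
      unfolding z1_def using measure_distr[OF rm2(1)] A mrestr[OF U rA] space_nonneg[OF z2]
      by (simp add: z2_def)
    also have "\<dots> = (\<Sum>i\<in>{i \<in> {1..k}. t i \<in> A}. measure z (N i))"
      unfolding eq using N sz
      by (intro finite_measure_finite_Union) (auto simp: disjoint_family_on_def)
    also have "\<dots> = (\<Sum>i=1..k. if t i \<in> A then measure z (N i) else 0)"
      by (subst sum.inter_filter) auto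
    also have "\<dots> = (\<Sum>i=1..k. measure z (N i) * indicator A (t i))"
      by (intro sum.cong) auto
    finally show ?thesis .
  qed
  have mass: "measure z1 {0..1} = measure z2 {0..1}"
    unfolding z1_def using measure_distr[OF rm2(1) unit_borel_interval] r01 space_nonneg[OF z2]
    by (simp add: Int_absorb1 subset_iff)
  have tv1: "tv_norm (\<lambda>A. measure (discrete_measure k a t) A - measure z1 A)
      \<le> (\<Sum>i=1..k. \<bar>a i - measure z (N i)\<bar>)"
  proof -
    let ?\<nu> = "discrete_measure k (\<lambda>i. \<bar>a i - measure z (N i)\<bar>) t"
    have "tv_norm (\<lambda>A. measure (discrete_measure k a t) A - measure z1 A) \<le> measure ?\<nu> {0..1}"
    proof (rule tv_norm_le)
      show "?\<nu> \<in> nonneg_measures" using t by (intro discrete_measure_nonneg) auto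
      fix A assume A: "A \<in> sets unit_borel"
      have "measure (discrete_measure k a t) A - measure z1 A
          = (\<Sum>i=1..k. (a i - measure z (N i)) * indicator A (t i))"
        using measure_discrete_measure[OF t a A] mz1[OF A] by (simp add: sum_subtractf left_diff_distrib)
      also have "\<bar>\<dots>\<bar> \<le> (\<Sum>i=1..k. \<bar>(a i - measure z (N i)) * indicator A (t i)\<bar>)" by (rule sum_abs)
      also have "\<dots> = measure ?\<nu> A"
        using A t by (subst measure_discrete_measure) (auto simp: abs_mult)
      finally show "\<bar>measure (discrete_measure k a t) A - measure z1 A\<bar> \<le> measure ?\<nu> A" .
    qed
    also have "measure ?\<nu> {0..1} = (\<Sum>i=1..k. \<bar>a i - measure z (N i)\<bar>)"
      using t by (intro mass_discrete_measure) auto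
    finally show ?thesis .
  qed
  have tv2: "tv_norm (\<lambda>A. measure z A - measure z2 A) \<le> measure z ({0..1} - U)"
  proof -
    let ?V = "{0..1} - U"
    have V: "?V \<in> sets unit_borel" using U unit_borel_interval by blast
    have "tv_norm (\<lambda>A. measure z A - measure z2 A) \<le> measure (density z (indicator ?V)) {0..1}"
    proof (rule tv_norm_le[OF restr[OF V]])
      fix A assume A: "A \<in> sets unit_borel"
      have "A \<subseteq> {0..1}" using sets.sets_into_space[OF A] by simp
      then have "measure z A = measure z (U \<inter> A) + measure z (?V \<inter> A)"
        using A U V sz by (subst finite_measure_Union[symmetric]) (auto intro!: arg_cong[where f = "measure z"])
      then show "\<bar>measure z A - measure z2 A\<bar> \<le> measure (density z (indicator ?V)) A"
        using mrestr[OF U A] mrestr[OF V A] by (simp add: z2_def)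
    qed
    also have "\<dots> = measure z ?V"
      unfolding mrestr[OF V unit_borel_interval] by (simp add: Int_absorb2 Diff_subset)
    finally show ?thesis .
  qed
  have W: "(\<integral>p. \<bar>fst p - snd p\<bar> \<partial>\<gamma>) \<le> \<rho> * measure z {0..1}"
  proof -
    have bm: "r \<in> borel_measurable z" "(\<lambda>x. x) \<in> borel_measurable z"
      using rm measurable_cong_sets[OF sz refl] continuous_borel_measurable_nonneg[OF z]
      by (auto simp: measurable_restrict_space2_iff continuous_on_id)
    have "(\<integral>p. \<bar>fst p - snd p\<bar> \<partial>\<gamma>) = (\<integral>x. \<bar>r x - x\<bar> \<partial>z2)"
    proof -
      have "(\<lambda>p. \<bar>fst p - snd p\<bar>) \<in> borel_measurable (unit_borel \<Otimes>\<^sub>M unit_borel)"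
        by (intro borel_measurable_abs borel_measurable_diff
            measurable_compose[OF measurable_fst] measurable_compose[OF measurable_snd]
            borel_measurable_continuous_on_restrict continuous_on_id)
      then show ?thesis unfolding \<gamma>_def using pm by (subst integral_distr) auto
    qed
    also have "\<dots> = (\<integral>x. indicator U x * \<bar>r x - x\<bar> \<partial>z)"
    proof -
      have "z2 = density z (\<lambda>x. ennreal (indicator U x))" unfolding z2_def by (simp add: ennreal_indicator)
      then show ?thesis using bm U sz integral_density[of "\<lambda>x. \<bar>r x - x\<bar>" z "indicator U"] by simp
    qed
    also have "\<dots> \<le> (\<integral>x. \<rho> \<partial>z)"
    proof (rule integral_mono')
      fix x
      show "indicator U x * \<bar>r x - x\<bar> \<le> \<rho>"
        using rN \<rho> by (auto simp: U_def indicator_def abs_minus_commute)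
    qed (use \<rho> in auto)
    finally show ?thesis using spz by (simp add: mult.commute)
  qed
  show ?thesis
    using d_GW_le[OF discrete_measure_nonneg[OF t a] z z1 z2 \<gamma> mass] tv1 tv2 W unfolding U_def by linarith
qed

section \<open>Stability from certificates\<close>

text \<open>
  Fix small disjoint neighbourhoods \<open>N i\<close> of the support points. Off these, \<open>q\<close> is bounded below by
  some \<open>c > 0\<close>, so the mass there is at most \<open>K * \<delta> / c\<close>. On them, \<open>p i\<close> is close to the indicator
  function of \<open>N i\<close>, which turns the bound on \<open>\<integral>p i\<close> into one on the mass of \<open>N i\<close>. The remaining
  errors are proportional to the total mass, which \<open>w\<close> controls by \<open>\<delta>\<close> and the amplitudes; a
  sufficiently small oscillation \<open>\<eta>\<close> of the \<open>p i\<close> on the neighbourhoods makes the coefficient of the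
  amplitudes smaller than \<open>\<epsilon>\<close>.
\<close>

lemma stability_from_dual_functions:
  fixes t :: "nat \<Rightarrow> real" and q w :: "real \<Rightarrow> real" and p :: "nat \<Rightarrow> real \<Rightarrow> real"
  assumes t: "inj_on t {1..k}" "t ` {1..k} \<subseteq> {0..1}"
    and q: "continuous_on {0..1} q" "\<And>x. x \<in> {0..1} \<Longrightarrow> 0 \<le> q x"
       "\<And>x. x \<in> {0..1} \<Longrightarrow> q x = 0 \<longleftrightarrow> x \<in> t ` {1..k}"
    and p: "\<And>i. i \<in> {1..k} \<Longrightarrow> continuous_on {0..1} (p i)"
       "\<And>i l. i \<in> {1..k} \<Longrightarrow> l \<in> {1..k} \<Longrightarrow> p i (t l) = (if l = i then 1 else 0)"
    and w: "continuous_on {0..1} w" "\<And>x. x \<in> {0..1} \<Longrightarrow> 0 < w x"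
    and K: "0 \<le> K" and \<epsilon>: "0 < \<epsilon>"
  shows "\<exists>C\<ge>0. \<forall>a \<delta> z. (\<forall>i\<in>{1..k}. 0 \<le> a i) \<longrightarrow> 0 \<le> \<delta> \<longrightarrow> z \<in> nonneg_measures \<longrightarrow>
     (\<forall>u\<in>insert q (insert w (p ` {1..k})). \<bar>(\<integral>x. u x \<partial>z) - (\<Sum>i=1..k. a i * u (t i))\<bar> \<le> K * \<delta>) \<longrightarrow>
     d_GW (discrete_measure k a t) z \<le> C * \<delta> + \<epsilon> * (\<Sum>i=1..k. a i)"
proof -
  have t01: "t i \<in> {0..1}" if "i \<in> {1..k}" for i using t(2) that by blast
  have "bounded (\<Union>i\<in>{1..k}. p i ` {0..1})"
    using p(1) by (intro compact_imp_bounded compact_UN compact_continuous_image) auto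
  then obtain B where B: "B > 0" "\<And>i x. i \<in> {1..k} \<Longrightarrow> x \<in> {0..1} \<Longrightarrow> \<bar>p i x\<bar> \<le> B"
    unfolding bounded_pos by auto
  obtain x0 where x0: "x0 \<in> {0..1}" "\<And>x. x \<in> {0..1} \<Longrightarrow> w x0 \<le> w x"
    using continuous_attains_inf[OF _ _ w(1)] by fastforce
  define w0 where "w0 = w x0"
  have w0: "w0 > 0" "\<And>x. x \<in> {0..1} \<Longrightarrow> w0 \<le> w x" using x0 w(2) by (auto simp: w0_def)
  have "bounded (w ` {0..1})"
    by (intro compact_imp_bounded compact_continuous_image w(1)) simp
  then obtain W where "W > 0" "\<forall>y\<in>w ` {0..1}. norm y \<le> W" unfolding bounded_pos by blast
  then have W: "W > 0" "\<And>x. x \<in> {0..1} \<Longrightarrow> w x \<le> W" by (auto simp: abs_le_iff)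
  (* 1/3 makes the neighbourhoods disjoint: p i is near 1 on N i and near 0 on the others *)
  define \<eta> where "\<eta> = min (1/3) (\<epsilon> * w0 / ((real k + 1) * (W + 1)))"
  have \<eta>: "0 < \<eta>" "\<eta> \<le> 1/3" "\<eta> * (real k + 1) * (W + 1) \<le> \<epsilon> * w0"
  proof -
    let ?D = "(real k + 1) * (W + 1)"
    have D: "0 < ?D" using W by simp
    then show "0 < \<eta>" unfolding \<eta>_def using w0(1) \<epsilon> by simp
    show "\<eta> \<le> 1/3" unfolding \<eta>_def by (rule min.cobounded1)
    have "\<eta> \<le> \<epsilon> * w0 / ?D" unfolding \<eta>_def by simp
    then show "\<eta> * (real k + 1) * (W + 1) \<le> \<epsilon> * w0" using D by (simp add: pos_le_divide_eq mult.assoc)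
  qed
  have "\<exists>d>0. \<forall>x\<in>{0..1}. \<forall>l\<in>{1..k}. \<bar>x - t l\<bar> < d \<longrightarrow> \<bar>p i x - p i (t l)\<bar> < \<eta>" if i: "i \<in> {1..k}" for i
  proof -
    have "uniformly_continuous_on {0..1} (p i)"
      using compact_uniformly_continuous[OF p(1)[OF i]] by simp
    then obtain d where "d > 0" "\<And>x x'. x \<in> {0..1} \<Longrightarrow> x' \<in> {0..1} \<Longrightarrow> dist x' x < d \<Longrightarrow> dist (p i x') (p i x) < \<eta>"
      using \<eta>(1) unfolding uniformly_continuous_on_def by metis
    then show ?thesis using t(2) by (intro exI[of _ d]) (auto simp: dist_real_def)
  qed
  then obtain d where d: "\<And>i. i \<in> {1..k} \<Longrightarrow> 0 < d i"
      "\<And>i x l. i \<in> {1..k} \<Longrightarrow> x \<in> {0..1} \<Longrightarrow> l \<in> {1..k} \<Longrightarrow> \<bar>x - t l\<bar> < d i \<Longrightarrow> \<bar>p i x - p i (t l)\<bar> < \<eta>"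
    by metis
  define \<rho> where "\<rho> = Min (insert \<eta> (d ` {1..k}))"
  have \<rho>: "0 < \<rho>" "\<rho> \<le> \<eta>" unfolding \<rho>_def using \<eta>(1) d(1) by auto
  have \<rho>d: "\<rho> \<le> d i" if "i \<in> {1..k}" for i unfolding \<rho>_def using that by (intro Min_le) auto
  define N where "N i = {0..1} \<inter> ball (t i) \<rho>" for i
  have N: "x \<in> N i \<longleftrightarrow> x \<in> {0..1} \<and> \<bar>x - t i\<bar> < \<rho>" for x i
    unfolding N_def by (auto simp: dist_real_def abs_minus_commute)
  have NB: "N i \<in> sets unit_borel" for i unfolding N_def by (auto simp: sets_restrict_space)
  have pN: "\<bar>p i x - (if l = i then 1 else 0)\<bar> < \<eta>" if "i \<in> {1..k}" "l \<in> {1..k}" "x \<in> N l" for i l x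
    using d(2)[of i x l] p(2)[of i l] \<rho>d[of i] that unfolding N by auto
  have disj: "disjoint_family_on N {1..k}"
    unfolding disjoint_family_on_def
  proof (intro ballI impI equals0I)
    fix i l x assume "i \<in> {1..k}" "l \<in> {1..k}" "i \<noteq> l" "x \<in> N i \<inter> N l"
    then have "\<bar>p i x - 1\<bar> < \<eta>" "\<bar>p i x\<bar> < \<eta>" using pN[of i i x] pN[of i l x] by auto
    then show False using \<eta>(2) by linarith
  qed
  define F where "F = {0..1} - (\<Union>i\<in>{1..k}. N i)"
  have "F = {0..1} - (\<Union>i\<in>{1..k}. ball (t i) \<rho>)" unfolding F_def N_def by auto
  then have "compact F" by (auto intro!: compact_diff)
  have "\<exists>c>0. \<forall>x\<in>F. c \<le> q x"
  proof (cases "F = {}")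
    case False
    obtain x1 where x1: "x1 \<in> F" "\<forall>x\<in>F. q x1 \<le> q x"
      using continuous_attains_inf[OF \<open>compact F\<close> False continuous_on_subset[OF q(1)]] unfolding F_def by auto
    have "x1 \<notin> t ` {1..k}" using x1(1) \<rho>(1) t(2) unfolding F_def by (auto simp: N)
    then have "q x1 \<noteq> 0" using q(3) x1(1) unfolding F_def by auto
    then have "0 < q x1" using q(2)[of x1] x1(1) unfolding F_def by auto
    then show ?thesis using x1(2) by blast
  qed (auto intro: exI[of _ 1])
  then obtain c where c: "0 < c" "\<And>x. x \<in> F \<Longrightarrow> c \<le> q x" by blast
  (* far mass K / c, near mass errors K * (1 + B / c) for each i, and the delta part of the total mass *)
  define C where "C = real k * K * (1 + B / c) + K / c + \<epsilon> * K"
  have "C \<ge> 0" unfolding C_def using K B c \<epsilon> by simp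
  moreover have "d_GW (discrete_measure k a t) z \<le> C * \<delta> + \<epsilon> * (\<Sum>i=1..k. a i)"
    if a: "\<forall>i\<in>{1..k}. 0 \<le> a i" and \<delta>: "0 \<le> \<delta>" and z: "z \<in> nonneg_measures"
    and K': "\<forall>u\<in>insert q (insert w (p ` {1..k})). \<bar>(\<integral>x. u x \<partial>z) - (\<Sum>i=1..k. a i * u (t i))\<bar> \<le> K * \<delta>"
    for a \<delta> z
  proof -
    interpret finite_measure z using finite_nonneg[OF z] .
    note sz = sets_nonneg[OF z] and spz = space_nonneg[OF z]
    note int = continuous_integrable_nonneg[OF z]
    define M where "M = measure z {0..1}"
    define A where "A = (\<Sum>i=1..k. a i)"
    have A: "0 \<le> A" unfolding A_def using a by (intro sum_nonneg) auto
    have Q: "(\<integral>x. q x \<partial>z) \<le> K * \<delta>"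
    proof -
      have "(\<Sum>i=1..k. a i * q (t i)) = 0" using q(3) t(2) by (intro sum.neutral) auto
      then show ?thesis using K' by (simp add: abs_le_iff)
    qed
    have M: "w0 * M \<le> K * \<delta> + W * A"
    proof -
      have "w0 * M = (\<integral>x. w0 \<partial>z)" using spz by (simp add: M_def mult.commute)
      also have "\<dots> \<le> (\<integral>x. w x \<partial>z)"
        using w0 w(2) spz by (intro integral_mono int[OF w(1)]) auto
      also have "\<dots> \<le> K * \<delta> + (\<Sum>i=1..k. a i * w (t i))" using K' by (simp add: abs_le_iff)
      also have "(\<Sum>i=1..k. a i * w (t i)) \<le> (\<Sum>i=1..k. a i * W)"
        using W(2)[OF t01] a by (intro sum_mono mult_left_mono) blast+
      finally show ?thesis by (simp add: A_def sum_distrib_left mult.commute)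
    qed
    have FB: "F \<in> sets z" unfolding F_def sz
      using NB unit_borel_interval by (intro sets.Diff sets.finite_UN) auto
    have off: "measure z F \<le> K * \<delta> / c"
    proof -
      have "measure z F = (\<integral>x. indicator F x \<partial>z)" using FB by simp
      also have "\<dots> \<le> (\<integral>x. q x / c \<partial>z)"
      proof (rule integral_mono)
        show "integrable z (\<lambda>x. q x / c)" using int[OF q(1)] by simp
        show "integrable z (indicator F :: real \<Rightarrow> real)"
          using FB by (simp add: less_top[symmetric])
        fix x assume "x \<in> space z"
        then show "indicator F x \<le> q x / c" using c q(2)[of x] spz by (auto simp: indicator_def field_simps)
      qed
      also have "\<dots> = (\<integral>x. q x \<partial>z) / c" by simp
      finally show ?thesis using Q c(1) by (meson divide_right_mono less_imp_le order_trans)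
    qed
    have near: "\<bar>a i - measure z (N i)\<bar> \<le> K * \<delta> + (\<eta> * M + B / c * (K * \<delta>))" if i: "i \<in> {1..k}" for i
    proof -
      have Ni: "N i \<in> sets z" using NB sz by simp
      have "(\<Sum>l=1..k. a l * p i (t l)) = (\<Sum>l=1..k. if l = i then a l else 0)"
        using p(2)[OF i] by (intro sum.cong) auto
      then have "(\<Sum>l=1..k. a l * p i (t l)) = a i" using i by simp
      moreover have "\<bar>(\<integral>x. p i x \<partial>z) - (\<Sum>l=1..k. a l * p i (t l))\<bar> \<le> K * \<delta>" using K' i by blast
      ultimately have 1: "\<bar>(\<integral>x. p i x \<partial>z) - a i\<bar> \<le> K * \<delta>" by (simp only:)
      have intN: "integrable z (indicator (N i) :: real \<Rightarrow> real)"
        using Ni by (simp add: less_top[symmetric])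
      have "\<bar>(\<integral>x. p i x \<partial>z) - measure z (N i)\<bar> = \<bar>\<integral>x. p i x - indicator (N i) x \<partial>z\<bar>"
        using int[OF p(1)[OF i]] intN Ni by simp
      also have "\<dots> \<le> (\<integral>x. \<bar>p i x - indicator (N i) x\<bar> \<partial>z)" by (rule integral_abs_bound)
      also have "\<dots> \<le> (\<integral>x. \<eta> + B / c * q x \<partial>z)"
      proof (rule integral_mono)
        show "integrable z (\<lambda>x. \<bar>p i x - indicator (N i) x\<bar>)"
          using int[OF p(1)[OF i]] intN by simp
        show "integrable z (\<lambda>x. \<eta> + B / c * q x)" using int[OF q(1)] by simp
        fix x assume "x \<in> space z"
        then have x: "x \<in> {0..1}" using spz by simp
        show "\<bar>p i x - indicator (N i) x\<bar> \<le> \<eta> + B / c * q x"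
        proof (cases "x \<in> F")
          case True
          then have "B \<le> B / c * q x" using c B(1) by (simp add: field_simps)
          moreover have "indicator (N i) x = (0::real)" using True i unfolding F_def by auto
          ultimately show ?thesis using B(2)[OF i x] \<eta>(1) by simp
        next
          case False
          then obtain l where l: "l \<in> {1..k}" "x \<in> N l" using x unfolding F_def by blast
          have "x \<in> N i \<longleftrightarrow> l = i" using l i disj unfolding disjoint_family_on_def by blast
          then have "indicator (N i) x = (if l = i then 1 else (0::real))" by simp
          moreover have "0 \<le> B / c * q x" using q(2)[OF x] B(1) c(1) by simp
          ultimately show ?thesis using pN[OF i l] by simp
        qed
      qed
      also have "\<dots> = \<eta> * M + B / c * (\<integral>x. q x \<partial>z)"
        using int[OF q(1)] spz by (simp add: M_def)
      also have "\<dots> \<le> \<eta> * M + B / c * (K * \<delta>)" using Q B(1) c(1) by (intro add_left_mono mult_left_mono) auto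
      finally show ?thesis using 1 by linarith
    qed
    have "d_GW (discrete_measure k a t) z
       \<le> (\<Sum>i=1..k. \<bar>a i - measure z (N i)\<bar>) + \<rho> * M + measure z F"
      unfolding M_def F_def using N NB disj \<rho>(1) t(2) a z
      by (intro d_GW_discrete_le) (auto simp: less_imp_le)
    also have "\<dots> \<le> (\<Sum>i=1..k. K * \<delta> + (\<eta> * M + B / c * (K * \<delta>))) + \<eta> * M + K * \<delta> / c"
      using near off \<rho>(2) by (intro add_mono sum_mono mult_right_mono) (auto simp: M_def)
    also have "\<dots> = (real k * K * (1 + B / c) + K / c) * \<delta> + \<eta> * (real k + 1) * M"
      by (simp add: algebra_simps add_divide_distrib)
    also have "\<eta> * (real k + 1) * M \<le> \<epsilon> * K * \<delta> + \<epsilon> * A"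
    proof -
      have "\<eta> * (real k + 1) * M * (w0 * (W + 1)) = (\<eta> * (real k + 1) * (W + 1)) * (w0 * M)" by simp
      also have "\<dots> \<le> (\<epsilon> * w0) * (K * \<delta> + W * A)"
      proof (rule mult_mono[OF \<eta>(3) M])
        show "0 \<le> \<epsilon> * w0" "0 \<le> w0 * M" using \<epsilon> w0(1) by (simp_all add: M_def)
      qed
      also have "\<dots> \<le> (\<epsilon> * w0) * ((W + 1) * (K * \<delta> + A))"
      proof (rule mult_left_mono)
        have "0 \<le> W * (K * \<delta>) + A" using W(1) K \<delta> A by simp
        then show "K * \<delta> + W * A \<le> (W + 1) * (K * \<delta> + A)" by (simp add: algebra_simps)
      qed (use \<epsilon> w0 in auto)
      also have "\<dots> = (\<epsilon> * K * \<delta> + \<epsilon> * A) * (w0 * (W + 1))" by (simp add: algebra_simps)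
      finally show ?thesis using w0(1) W(1) by (simp add: mult_le_cancel_right)
    qed
    finally show ?thesis unfolding C_def A_def by (simp add: algebra_simps)
  qed
  ultimately show ?thesis by blast
qed

lemma gauss_window_continuous: "continuous_on A (gauss_window \<sigma> s j)"
  unfolding gauss_window_def divide_inverse by (intro continuous_intros)

text \<open>
  One \<open>\<delta>\<close> comes from the noise and one from the tolerance of the program.
\<close>

lemma moment_error:
  assumes t: "t ` {1..k} \<subseteq> {0..1}" and a: "\<forall>i\<in>{1..k}. 0 \<le> a i" and \<delta>: "0 \<le> \<delta>"
    and noise: "(\<Sum>j=1..m. (noise j)\<^sup>2) \<le> \<delta>\<^sup>2"
    and y: "\<forall>j\<in>{1..m}. y j = (\<integral>x. \<phi> j x \<partial>discrete_measure k a t) + noise j"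
    and z: "is_solution m \<phi> y \<delta> z"
    and \<phi>: "\<And>j. j \<in> {1..m} \<Longrightarrow> continuous_on {0..1} (\<phi> j)" and j: "j \<in> {1..m}"
  shows "\<bar>(\<integral>x. \<phi> j x \<partial>z) - (\<Sum>i=1..k. a i * \<phi> j (t i))\<bar> \<le> 2 * \<delta>"
proof -
  have "\<bar>y j - (\<integral>x. \<phi> j x \<partial>z)\<bar> = L2_set (\<lambda>j. y j - (\<integral>x. \<phi> j x \<partial>z)) {j}"
    by (simp add: L2_set_def)
  also have "\<dots> \<le> L2_set (\<lambda>j. y j - (\<integral>x. \<phi> j x \<partial>z)) {1..m}"
    unfolding L2_set_def using j by (intro real_sqrt_le_mono sum_mono2) auto
  also have "\<dots> \<le> \<delta>" using z by (simp add: is_solution_def)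
  finally have 1: "\<bar>y j - (\<integral>x. \<phi> j x \<partial>z)\<bar> \<le> \<delta>" .
  have "(noise j)\<^sup>2 \<le> (\<Sum>j=1..m. (noise j)\<^sup>2)" using j by (intro member_le_sum) auto
  then have "\<bar>noise j\<bar> \<le> \<bar>\<delta>\<bar>" using noise by (simp add: abs_le_square_iff)
  moreover have "(\<integral>x. \<phi> j x \<partial>discrete_measure k a t) = (\<Sum>i=1..k. a i * \<phi> j (t i))"
    using integral_discrete_measure[OF t a borel_measurable_continuous_on_restrict[OF \<phi>[OF j]]] .
  ultimately show ?thesis using 1 y j \<delta> by (auto simp: abs_le_iff)
qed

lemma span_error:
  fixes \<phi> :: "nat \<Rightarrow> real \<Rightarrow> real" and a t :: "nat \<Rightarrow> real"
  assumes z: "z \<in> nonneg_measures"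
    and \<phi>: "\<And>j. j \<in> {1..m} \<Longrightarrow> continuous_on {0..1} (\<phi> j)"
    and err: "\<And>j. j \<in> {1..m} \<Longrightarrow> \<bar>(\<integral>x. \<phi> j x \<partial>z) - (\<Sum>i=1..k. a i * \<phi> j (t i))\<bar> \<le> e"
    and u: "\<And>x. u x = (\<Sum>j=1..m. \<beta> j * \<phi> j x)"
  shows "\<bar>(\<integral>x. u x \<partial>z) - (\<Sum>i=1..k. a i * u (t i))\<bar> \<le> (\<Sum>j=1..m. \<bar>\<beta> j\<bar>) * e"
proof -
  have "(\<integral>x. u x \<partial>z) = (\<Sum>j=1..m. \<integral>x. \<beta> j * \<phi> j x \<partial>z)"
    unfolding u
    by (rule Bochner_Integration.integral_sum)
      (intro integrable_mult_right continuous_integrable_nonneg[OF z] \<phi>)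
  then have "(\<integral>x. u x \<partial>z) = (\<Sum>j=1..m. \<beta> j * (\<integral>x. \<phi> j x \<partial>z))" by simp
  moreover have "(\<Sum>i=1..k. a i * u (t i)) = (\<Sum>j=1..m. \<beta> j * (\<Sum>i=1..k. a i * \<phi> j (t i)))"
    unfolding u sum_distrib_left by (subst sum.swap) (simp add: mult_ac)
  ultimately have "(\<integral>x. u x \<partial>z) - (\<Sum>i=1..k. a i * u (t i))
      = (\<Sum>j=1..m. \<beta> j * ((\<integral>x. \<phi> j x \<partial>z) - (\<Sum>i=1..k. a i * \<phi> j (t i))))"
    by (simp add: right_diff_distrib sum_subtractf)
  also have "\<bar>\<dots>\<bar> \<le> (\<Sum>j=1..m. \<bar>\<beta> j * ((\<integral>x. \<phi> j x \<partial>z) - (\<Sum>i=1..k. a i * \<phi> j (t i)))\<bar>)"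
    by (rule sum_abs)
  also have "\<dots> \<le> (\<Sum>j=1..m. \<bar>\<beta> j\<bar> * e)"
    unfolding abs_mult using err by (intro sum_mono mult_left_mono) auto
  finally show ?thesis by (simp add: sum_distrib_right)
qed

lemma gauss_stability:
  assumes s: "strict_mono_on {1..m} s" and \<sigma>: "0 < \<sigma>" and t: "inj_on t {1..k}" "t ` {1..k} \<subseteq> {0..1}"
    and m: "2 * k + 1 \<le> m" and \<epsilon>: "0 < \<epsilon>"
  shows "\<exists>C\<ge>0. \<forall>a \<delta> noise y z. (\<forall>i\<in>{1..k}. 0 \<le> a i) \<longrightarrow> 0 \<le> \<delta> \<longrightarrow> (\<Sum>j=1..m. (noise j)\<^sup>2) \<le> \<delta>\<^sup>2 \<longrightarrow>
     (\<forall>j\<in>{1..m}. y j = (\<integral>x. gauss_window \<sigma> s j x \<partial>discrete_measure k a t) + noise j) \<longrightarrow>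
     is_solution m (gauss_window \<sigma> s) y \<delta> z \<longrightarrow>
     d_GW (discrete_measure k a t) z \<le> C * \<delta> + \<epsilon> * (\<Sum>i=1..k. a i)"
proof -
  let ?\<phi> = "gauss_window \<sigma> s"
  have card: "card (t ` {1..k}) = k" using card_image[OF t(1)] by simp
  obtain \<beta>q where \<beta>q: "\<And>x. 0 \<le> (\<Sum>j=1..m. \<beta>q j * ?\<phi> j x)"
     "\<And>x. (\<Sum>j=1..m. \<beta>q j * ?\<phi> j x) = 0 \<longleftrightarrow> x \<in> t ` {1..k}"
    using gauss_dual_polynomial[OF s \<sigma>, of "t ` {1..k}"] card m by auto
  have "\<exists>\<beta>. \<forall>x\<in>t ` {1..k}. (\<Sum>j=1..m. \<beta> j * ?\<phi> j x) = (if x = t i then 1 else 0)" if "i \<in> {1..k}" for i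
    using gauss_interpolation[OF s \<sigma>, of "t ` {1..k}" "t i"] card m that by auto
  then obtain \<beta>p where \<beta>p: "\<And>i x. i \<in> {1..k} \<Longrightarrow> x \<in> t ` {1..k} \<Longrightarrow>
      (\<Sum>j=1..m. \<beta>p i j * ?\<phi> j x) = (if x = t i then 1 else 0)" by metis
  define q where "q x = (\<Sum>j=1..m. \<beta>q j * ?\<phi> j x)" for x
  define p where "p i x = (\<Sum>j=1..m. \<beta>p i j * ?\<phi> j x)" for i x
  define K where "K = 2 * ((\<Sum>j=1..m. \<bar>\<beta>q j\<bar>) + 1 + (\<Sum>i=1..k. \<Sum>j=1..m. \<bar>\<beta>p i j\<bar>))"
  have K0: "0 \<le> K" unfolding K_def by (intro mult_nonneg_nonneg add_nonneg_nonneg sum_nonneg) auto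
  have "\<exists>C\<ge>0. \<forall>a \<delta> z. (\<forall>i\<in>{1..k}. 0 \<le> a i) \<longrightarrow> 0 \<le> \<delta> \<longrightarrow> z \<in> nonneg_measures \<longrightarrow>
     (\<forall>u\<in>insert q (insert (?\<phi> 1) (p ` {1..k})). \<bar>(\<integral>x. u x \<partial>z) - (\<Sum>i=1..k. a i * u (t i))\<bar> \<le> K * \<delta>) \<longrightarrow>
     d_GW (discrete_measure k a t) z \<le> C * \<delta> + \<epsilon> * (\<Sum>i=1..k. a i)"
  proof (rule stability_from_dual_functions[OF t])
    show "continuous_on {0..1} q" "\<And>i. continuous_on {0..1} (p i)"
      unfolding q_def p_def by (intro continuous_intros gauss_window_continuous)+
    show "0 \<le> q x" "q x = 0 \<longleftrightarrow> x \<in> t ` {1..k}" for x using \<beta>q unfolding q_def by auto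
    show "p i (t l) = (if l = i then 1 else 0)" if "i \<in> {1..k}" "l \<in> {1..k}" for i l
    proof -
      have "t l = t i \<longleftrightarrow> l = i" using inj_on_eq_iff[OF t(1)] that by blast
      then show ?thesis using \<beta>p[of i "t l"] that unfolding p_def by simp
    qed
    show "continuous_on {0..1} (?\<phi> 1)" by (rule gauss_window_continuous)
    show "0 < ?\<phi> 1 x" for x unfolding gauss_window_def by simp
  qed (use K0 \<epsilon> in auto)
  then obtain C where C: "C \<ge> 0" "\<forall>a \<delta> z. (\<forall>i\<in>{1..k}. 0 \<le> a i) \<longrightarrow> 0 \<le> \<delta> \<longrightarrow> z \<in> nonneg_measures \<longrightarrow>
     (\<forall>u\<in>insert q (insert (?\<phi> 1) (p ` {1..k})). \<bar>(\<integral>x. u x \<partial>z) - (\<Sum>i=1..k. a i * u (t i))\<bar> \<le> K * \<delta>) \<longrightarrow>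
     d_GW (discrete_measure k a t) z \<le> C * \<delta> + \<epsilon> * (\<Sum>i=1..k. a i)" by blast
  have "d_GW (discrete_measure k a t) z \<le> C * \<delta> + \<epsilon> * (\<Sum>i=1..k. a i)"
    if a: "\<forall>i\<in>{1..k}. 0 \<le> a i" and \<delta>: "0 \<le> \<delta>" and noise: "(\<Sum>j=1..m. (noise j)\<^sup>2) \<le> \<delta>\<^sup>2"
      and y: "\<forall>j\<in>{1..m}. y j = (\<integral>x. ?\<phi> j x \<partial>discrete_measure k a t) + noise j"
      and z: "is_solution m ?\<phi> y \<delta> z" for a \<delta> noise y z
  proof -
    have zn: "z \<in> nonneg_measures" using z unfolding is_solution_def by blast
    note err = moment_error[OF t(2) a \<delta> noise y z gauss_window_continuous]
    have span: "\<bar>(\<integral>x. u x \<partial>z) - (\<Sum>i=1..k. a i * u (t i))\<bar> \<le> (\<Sum>j=1..m. \<bar>\<beta> j\<bar>) * (2 * \<delta>)"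
      if "\<And>x. u x = (\<Sum>j=1..m. \<beta> j * ?\<phi> j x)" for u \<beta>
      by (rule span_error[OF zn gauss_window_continuous err that])
    have coeff: "(\<Sum>j=1..m. \<bar>\<beta> j\<bar>) * (2 * \<delta>) \<le> K * \<delta>"
      if "2 * (\<Sum>j=1..m. \<bar>\<beta> j\<bar>) \<le> K" for \<beta> :: "nat \<Rightarrow> real"
      using mult_right_mono[OF that \<delta>] by (simp add: mult_ac)
    have nn: "0 \<le> (\<Sum>j=1..m. \<bar>\<beta>q j\<bar>)" "0 \<le> (\<Sum>i=1..k. \<Sum>j=1..m. \<bar>\<beta>p i j\<bar>)"
      by (intro sum_nonneg, simp)+
    have "\<bar>(\<integral>x. q x \<partial>z) - (\<Sum>i=1..k. a i * q (t i))\<bar> \<le> K * \<delta>"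
      using order_trans[OF span[OF q_def] coeff[of \<beta>q]] nn unfolding K_def by simp
    moreover have "\<bar>(\<integral>x. ?\<phi> 1 x \<partial>z) - (\<Sum>i=1..k. a i * ?\<phi> 1 (t i))\<bar> \<le> K * \<delta>"
    proof -
      have "2 * \<delta> \<le> K * \<delta>" using \<delta> nn by (intro mult_right_mono) (auto simp: K_def)
      moreover have "1 \<in> {1..m}" using m by simp
      ultimately show ?thesis using err[of 1] by linarith
    qed
    moreover have "\<bar>(\<integral>x. p i x \<partial>z) - (\<Sum>l=1..k. a l * p i (t l))\<bar> \<le> K * \<delta>" if "i \<in> {1..k}" for i
    proof -
      have "(\<Sum>j=1..m. \<bar>\<beta>p i j\<bar>) \<le> (\<Sum>i=1..k. \<Sum>j=1..m. \<bar>\<beta>p i j\<bar>)"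
        using that by (intro member_le_sum[where f = "\<lambda>i. \<Sum>j=1..m. \<bar>\<beta>p i j\<bar>"]) (auto intro: sum_nonneg)
      also have "\<dots> \<le> (\<Sum>j=1..m. \<bar>\<beta>q j\<bar>) + 1 + (\<Sum>i=1..k. \<Sum>j=1..m. \<bar>\<beta>p i j\<bar>)"
        using nn(1) by (intro add_increasing) auto
      finally have "2 * (\<Sum>j=1..m. \<bar>\<beta>p i j\<bar>) \<le> K" unfolding K_def by (intro mult_left_mono) simp_all
      then show ?thesis using order_trans[OF span[OF p_def] coeff[of "\<beta>p i"]] by blast
    qed
    ultimately have "\<forall>u\<in>insert q (insert (?\<phi> 1) (p ` {1..k})).
        \<bar>(\<integral>x. u x \<partial>z) - (\<Sum>i=1..k. a i * u (t i))\<bar> \<le> K * \<delta>" by blast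
    with C(2) a \<delta> zn show ?thesis by blast
  qed
  then show ?thesis using C(1) by blast
qed

section \<open>The explicit constants\<close>

lemma sqrt_exp_1_le: "sqrt (exp 1) \<le> 9/5"
proof -
  have "sqrt (exp 1) \<le> sqrt ((9/5)\<^sup>2)" using exp_le by (intro real_sqrt_le_mono) (simp add: power2_eq_square)
  then show ?thesis by simp
qed

lemma exp_separation_less_1: "0 < D \<Longrightarrow> 0 < \<sigma> \<Longrightarrow> exp (- (D\<^sup>2 / \<sigma>\<^sup>2)) < (1::real)"
  by simp

lemma F_max_pos:
  assumes "0 < D" "0 < \<sigma>"
  shows "0 < F_max D \<sigma>"
proof -
  have "0 < 1 - exp (- (D\<^sup>2 / \<sigma>\<^sup>2))" using exp_separation_less_1[OF assms] by simp
  then show ?thesis unfolding F_max_def using assms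
    by (intro mult_pos_pos real_sqrt_gt_zero add_pos_nonneg mult_nonneg_nonneg add_nonneg_nonneg) auto
qed

text \<open>
  A positive \<open>\<eta>\<close> lies below the threshold, whose sign is that of \<open>F_min\<close>. This rules out the degenerate
  value 0 of the quotient \<open>F_max / F_min\<^sup>2\<close> at \<open>F_min = 0\<close>.
\<close>

lemma F_min_pos_if_eta_small:
  assumes "0 < \<eta>" "eta_small k D \<sigma> f0 f1 \<eta>" "0 < D" "0 < \<sigma>"
  shows "0 < F_min D \<sigma>"
proof -
  let ?S = "sqrt (80 * real k + 8 + real k * P_const \<sigma> * (2 / (1 - exp (- (D\<^sup>2 / \<sigma>\<^sup>2)))))"
  have "0 < 1 - exp (- (D\<^sup>2 / \<sigma>\<^sup>2))" using exp_separation_less_1[OF assms(3,4)] by simp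
  moreover have "0 \<le> P_const \<sigma>" unfolding P_const_def by (intro add_nonneg_nonneg mult_nonneg_nonneg) auto
  ultimately have "0 \<le> ?S" by simp
  then have "0 \<le> 34 * (2 * real k + 2) * ?S" by simp
  moreover have "0 < 8 * F_min D \<sigma> / (34 * (2 * real k + 2) * ?S)"
    using assms(1,2) unfolding eta_small_def by (smt (verit) min.cobounded1)
  ultimately show ?thesis by (simp add: zero_less_divide_iff)
qed

lemma C_bar_ge_1: "0 < f0 \<Longrightarrow> 0 < f1 \<Longrightarrow> 1 \<le> C_bar f0 f1"
  unfolding C_bar_def by (simp add: add_nonneg_nonneg)

text \<open>
  Since \<open>C_bar \<ge> max 1 f0\<close>, the summand \<open>6 / \<eta> * (C_bar + 2 * k) powr (3 / 2)\<close> of the first factor of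
  \<open>F_1\<close> is at least \<open>3 * f0\<close>.
\<close>

lemma F_1_lower_bound:
  assumes "0 < \<eta>" "\<eta> \<le> 2" "0 < fbar" "0 < f0" "0 < f1" "0 \<le> F_max D \<sigma>"
  shows "3 * f0 * (sqrt (2 * real k + 2) / (1 - sqrt (exp 1) / 2) * (F_max D \<sigma> / (F_min D \<sigma>)\<^sup>2) ^ k)
      \<le> F_1 k D \<sigma> \<eta> fbar f0 f1"
proof -
  let ?P = "(C_bar f0 f1 + 2 * real k) powr (3 / 2)"
  have C: "1 \<le> C_bar f0 f1" "f0 \<le> C_bar f0 f1"
    using assms C_bar_ge_1 unfolding C_bar_def by (auto simp: add_nonneg_nonneg)
  have "f0 \<le> (C_bar f0 f1 + 2 * real k) powr 1" using C by simp
  also have "\<dots> \<le> ?P" using C by (intro powr_mono) auto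
  finally have "3 * f0 \<le> 6 / \<eta> * ?P"
    using assms by (intro mult_mono) (auto simp: field_simps)
  also have "\<dots> \<le> (6 + 2 / fbar) * sqrt (4 * real k + 5 + 4 * real k / \<sigma> ^ 4) * C_bar f0 f1 powr (5 / 4) + 6 / \<eta> * ?P"
    using assms(3) by simp
  finally have "3 * f0 \<le> \<dots>" .
  moreover have "0 \<le> sqrt (2 * real k + 2) / (1 - sqrt (exp 1) / 2) * (F_max D \<sigma> / (F_min D \<sigma>)\<^sup>2) ^ k"
  proof -
    have "0 \<le> 1 - sqrt (exp 1) / 2" using sqrt_exp_1_le by linarith
    then have "0 \<le> sqrt (2 * real k + 2) / (1 - sqrt (exp 1) / 2)" by (rule divide_nonneg_nonneg[rotated]) simp
    moreover have "0 \<le> (F_max D \<sigma> / (F_min D \<sigma>)\<^sup>2) ^ k" using assms(6) by simp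
    ultimately show ?thesis by (rule mult_nonneg_nonneg)
  qed
  ultimately have "3 * f0 * (sqrt (2 * real k + 2) / (1 - sqrt (exp 1) / 2) * (F_max D \<sigma> / (F_min D \<sigma>)\<^sup>2) ^ k)
    \<le> ((6 + 2 / fbar) * sqrt (4 * real k + 5 + 4 * real k / \<sigma> ^ 4) * C_bar f0 f1 powr (5 / 4) + 6 / \<eta> * ?P)
      * (sqrt (2 * real k + 2) / (1 - sqrt (exp 1) / 2) * (F_max D \<sigma> / (F_min D \<sigma>)\<^sup>2) ^ k)"
    by (rule mult_right_mono)
  then show ?thesis unfolding F_1_def by (simp only: mult.assoc)
qed

lemma exp_separation_less:
  assumes "0 < \<sigma>" "\<sigma>\<^sup>2 < 5" "\<sigma> * sqrt (ln (5 / \<sigma>\<^sup>2)) < D"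
  shows "exp (- (D\<^sup>2 / \<sigma>\<^sup>2)) < \<sigma>\<^sup>2 / 5"
proof -
  have ln: "0 \<le> ln (5 / \<sigma>\<^sup>2)" using assms by (intro ln_ge_zero) simp
  have "(\<sigma> * sqrt (ln (5 / \<sigma>\<^sup>2)))\<^sup>2 < D\<^sup>2"
    using assms ln by (intro power_strict_mono) auto
  then have "ln (5 / \<sigma>\<^sup>2) < D\<^sup>2 / \<sigma>\<^sup>2"
    using assms(1) ln by (simp add: power_mult_distrib field_simps)
  then have "exp (- (D\<^sup>2 / \<sigma>\<^sup>2)) < exp (- ln (5 / \<sigma>\<^sup>2))" by simp
  also have "\<dots> = \<sigma>\<^sup>2 / 5" using assms(1) by (simp add: exp_minus)
  finally show ?thesis .
qed

lemma F_min_lower_bound: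
  assumes "0 < \<sigma>" "\<sigma>\<^sup>2 < 1/3" and E: "exp (- (D\<^sup>2 / \<sigma>\<^sup>2)) < \<sigma>\<^sup>2 / 5"
  shows "(1 - 3 * \<sigma>\<^sup>2) / 5 \<le> F_min D \<sigma>"
proof -
  define v where "v = \<sigma>\<^sup>2"
  define e where "e = exp (- (D\<^sup>2 / \<sigma>\<^sup>2))"
  have v: "0 < v" "v < 1/3" and e: "0 < e" "e < v / 5" using assms by (auto simp: v_def e_def)
  have "2 * e / (1 - e) \<le> 2 * (v / 5) / (1 - v / 5)"
    using e v by (intro frac_le) auto
  also have "\<dots> = 2 * v / (5 - v)" using v by (simp add: field_simps)
  finally have "(1 + 2 / v) * (2 * e / (1 - e)) \<le> (1 + 2 / v) * (2 * v / (5 - v))"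
    using v by (intro mult_left_mono) auto
  also have "\<dots> = 2 * (v + 2) / (5 - v)" using v by (simp add: field_simps)
  also have "\<dots> \<le> 1 - (1 - 3 * v) / 5"
  proof -
    have "2 * (v + 2) * 5 \<le> (4 + 3 * v) * (5 - v)"
    proof -
      have "0 \<le> v * (1 - 3 * v)" using v by (intro mult_nonneg_nonneg) auto
      then show ?thesis by (simp add: algebra_simps)
    qed
    then show ?thesis using v by (simp add: field_simps)
  qed
  finally show ?thesis unfolding F_min_def v_def e_def by linarith
qed

lemma F_max_upper_bound:
  assumes "0 < \<sigma>" "\<sigma>\<^sup>2 < 1/3" and E: "exp (- (D\<^sup>2 / \<sigma>\<^sup>2)) < \<sigma>\<^sup>2 / 5"
  shows "F_max D \<sigma> \<le> 36 / \<sigma> ^ 6"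
proof -
  define v where "v = \<sigma>\<^sup>2"
  define e where "e = exp (- (D\<^sup>2 / \<sigma>\<^sup>2))"
  have v: "0 < v" "v < 1/3" and e: "0 < e" "e < v / 5" using assms by (auto simp: v_def e_def)
  have pw: "\<sigma> ^ 4 = v\<^sup>2" "\<sigma> ^ 6 = v ^ 3" "\<sigma> ^ 8 = v ^ 4" unfolding v_def by (simp_all flip: power_mult)
  have "1 / (1 - e) \<le> 3 / 2" using e v by (simp add: field_simps)
  then have r: "2 / (1 - e) \<le> 3" "16 / (1 - e) \<le> 24" by simp_all
  have v2: "v\<^sup>2 \<le> 1/9" "v ^ 4 \<le> 1/81"
    using power_mono[of v "1/3" 2] power_mono[of v "1/3" 4] v by (simp_all add: power_divide)
  have "8 + (1 + 4 / v\<^sup>2) * (2 / (1 - e)) \<le> 8 + (1 + 4 / v\<^sup>2) * 3"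
    using r by (intro add_left_mono mult_left_mono) auto
  also have "\<dots> = (11 * v\<^sup>2 + 12) / v\<^sup>2" using v by (simp add: field_simps)
  also have "\<dots> \<le> 16 / v\<^sup>2" using v2 by (intro divide_right_mono) auto
  finally have "sqrt (8 + (1 + 4 / v\<^sup>2) * (2 / (1 - e))) \<le> sqrt ((4 / v)\<^sup>2)"
    by (intro real_sqrt_le_mono) (simp add: power_divide)
  then have 1: "sqrt (8 + (1 + 4 / v\<^sup>2) * (2 / (1 - e))) \<le> 4 / v" using v by simp
  have "32 + (1 / v\<^sup>2 + 2 / v ^ 3 + 2 / v ^ 4) * (16 / (1 - e)) \<le> 32 + (1 / v\<^sup>2 + 2 / v ^ 3 + 2 / v ^ 4) * 24"
    using r v by (intro add_left_mono mult_left_mono) auto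
  also have "\<dots> = (32 * v ^ 4 + 24 * v\<^sup>2 + 48 * v + 48) / v ^ 4"
    using v by (simp add: field_simps power2_eq_square power3_eq_cube power4_eq_xxxx)
  also have "\<dots> \<le> 81 / v ^ 4" using v v2 by (intro divide_right_mono) auto
  finally have "sqrt (32 + (1 / v\<^sup>2 + 2 / v ^ 3 + 2 / v ^ 4) * (16 / (1 - e))) \<le> sqrt ((9 / v\<^sup>2)\<^sup>2)"
    by (intro real_sqrt_le_mono) (simp add: power_divide)
  then have 2: "sqrt (32 + (1 / v\<^sup>2 + 2 / v ^ 3 + 2 / v ^ 4) * (16 / (1 - e))) \<le> 9 / v\<^sup>2" using v by simp
  have "F_max D \<sigma> \<le> (4 / v) * (9 / v\<^sup>2)"
    unfolding F_max_def pw e_def[symmetric] using v e r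
    by (intro mult_mono 1 2) (auto intro!: add_nonneg_nonneg mult_nonneg_nonneg)
  also have "\<dots> = 36 / v ^ 3" by (simp add: power2_eq_square power3_eq_cube)
  finally show ?thesis unfolding pw .
qed

text \<open>
  Both summands in the first factor of \<open>F_1\<close> are bounded by a multiple of
  \<open>H = sqrt k * P / (\<eta> * fbar * \<sigma>\<^sup>2)\<close> with \<open>P = (C_bar + 2 * k) powr (3 / 2)\<close>; the multiples are 32 and 6.
  The factor \<open>sqrt (2 * k + 2) / (1 - sqrt e / 2)\<close> is at most \<open>20 * sqrt k\<close>, so the product has the
  constant 760.
\<close>

lemma F_1_upper_bound:
  assumes k: "1 \<le> k" and \<sigma>: "0 < \<sigma>" "\<sigma> < 1 / sqrt 3" and \<eta>: "0 < \<eta>" "\<eta> \<le> \<sigma>\<^sup>2"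
    and fbar: "0 < fbar" "fbar < 1" and f: "0 < f0" "0 < f1"
    and D: "\<sigma> * sqrt (ln (5 / \<sigma>\<^sup>2)) < D"
  shows "F_1 k D \<sigma> \<eta> fbar f0 f1
    < 800 * real k * C_1 k fbar f0 f1 / (\<eta> * \<sigma>\<^sup>2) * (900 / (\<sigma> ^ 6 * (1 - 3 * \<sigma>\<^sup>2)\<^sup>2)) ^ k"
proof -
  define v where "v = \<sigma>\<^sup>2"
  have "\<sigma>\<^sup>2 < (1 / sqrt 3)\<^sup>2" using \<sigma> by (intro power_strict_mono) auto
  then have v: "0 < v" "v < 1/3" using \<sigma>(1) by (auto simp: v_def power_divide)
  then have v3: "\<sigma>\<^sup>2 < 1/3" by (simp add: v_def)
  then have E: "exp (- (D\<^sup>2 / \<sigma>\<^sup>2)) < \<sigma>\<^sup>2 / 5" using D \<sigma>(1) by (intro exp_separation_less) auto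
  note Fmin = F_min_lower_bound[OF \<sigma>(1) v3 E] and Fmax = F_max_upper_bound[OF \<sigma>(1) v3 E]
  have "0 \<le> sqrt (ln (5 / \<sigma>\<^sup>2))" using \<sigma>(1) v3 by simp
  then have "0 < D" using D \<sigma>(1) by (smt (verit) mult_nonneg_nonneg)
  then have Fmax0: "0 < F_max D \<sigma>" using F_max_pos \<sigma>(1) by blast
  have "((1 - 3 * \<sigma>\<^sup>2) / 5)\<^sup>2 \<le> (F_min D \<sigma>)\<^sup>2" using Fmin v3 by (intro power_mono) auto
  then have "F_max D \<sigma> / (F_min D \<sigma>)\<^sup>2 \<le> (36 / \<sigma> ^ 6) / ((1 - 3 * \<sigma>\<^sup>2) / 5)\<^sup>2"
    using Fmax Fmax0 v3 by (intro frac_le) auto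
  also have "\<dots> = 900 / (\<sigma> ^ 6 * (1 - 3 * \<sigma>\<^sup>2)\<^sup>2)" by (simp add: power_divide)
  finally have Q: "(F_max D \<sigma> / (F_min D \<sigma>)\<^sup>2) ^ k \<le> (900 / (\<sigma> ^ 6 * (1 - 3 * \<sigma>\<^sup>2)\<^sup>2)) ^ k"
    using Fmax0 by (intro power_mono) auto
  have Q0: "0 < (900 / (\<sigma> ^ 6 * (1 - 3 * \<sigma>\<^sup>2)\<^sup>2)) ^ k" using \<sigma>(1) v3 by simp
  define P where "P = (C_bar f0 f1 + 2 * real k) powr (3 / 2)"
  have C: "1 \<le> C_bar f0 f1" using f by (rule C_bar_ge_1)
  then have P: "0 < P" unfolding P_def by (simp add: add_pos_nonneg)
  have "C_bar f0 f1 powr (5 / 4) \<le> C_bar f0 f1 powr (3 / 2)" using C by (intro powr_mono) auto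
  also have "\<dots> \<le> P" unfolding P_def using C by (intro powr_mono2) auto
  finally have CP: "C_bar f0 f1 powr (5 / 4) \<le> P" .
  have pw: "\<sigma> ^ 4 = v\<^sup>2" unfolding v_def by (simp flip: power_mult)
  have sq: "sqrt (4 * real k + 5 + 4 * real k / v\<^sup>2) \<le> 4 * sqrt (real k) / v"
  proof -
    have "v\<^sup>2 \<le> 1" using v by (simp add: power_le_one)
    then have "(4 * real k + 5) * v\<^sup>2 + 4 * real k \<le> (4 * real k + 5) * 1 + 4 * real k"
      by (intro add_right_mono mult_left_mono) auto
    also have "\<dots> \<le> 16 * real k" using k by simp
    finally have "(4 * real k + 5) * v\<^sup>2 + 4 * real k \<le> 16 * real k" .
    then have "((4 * real k + 5) * v\<^sup>2 + 4 * real k) / v\<^sup>2 \<le> 16 * real k / v\<^sup>2"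
      by (rule divide_right_mono) simp
    moreover have "((4 * real k + 5) * v\<^sup>2 + 4 * real k) / v\<^sup>2 = 4 * real k + 5 + 4 * real k / v\<^sup>2"
      using v by (simp add: add_divide_distrib)
    ultimately have "4 * real k + 5 + 4 * real k / v\<^sup>2 \<le> (4 * sqrt (real k) / v)\<^sup>2"
      by (simp add: power_divide power_mult_distrib)
    then have "sqrt (4 * real k + 5 + 4 * real k / v\<^sup>2) \<le> sqrt ((4 * sqrt (real k) / v)\<^sup>2)"
      by (rule real_sqrt_le_mono)
    then show ?thesis using v by simp
  qed
  have \<eta>1: "\<eta> \<le> 1" using \<eta>(2) v3 by simp
  define H where "H = sqrt (real k) * P / (\<eta> * fbar * v)"
  have H: "0 < H" unfolding H_def using k P \<eta> fbar v by simp
  have X: "(6 + 2 / fbar) * sqrt (4 * real k + 5 + 4 * real k / v\<^sup>2) * C_bar f0 f1 powr (5 / 4) \<le> 32 * H"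
  proof -
    have "6 + 2 / fbar \<le> 8 / fbar" using fbar by (simp add: field_simps)
    then have "(6 + 2 / fbar) * sqrt (4 * real k + 5 + 4 * real k / v\<^sup>2) * C_bar f0 f1 powr (5 / 4)
       \<le> (8 / fbar) * (4 * sqrt (real k) / v) * P"
      using fbar sq CP v by (intro mult_mono) (auto intro!: mult_nonneg_nonneg add_nonneg_nonneg)
    also have "\<dots> = 32 * H * \<eta>" unfolding H_def using \<eta>(1) by simp
    also have "\<dots> \<le> 32 * H * 1" using H \<eta>1 by (intro mult_left_mono) auto
    finally show ?thesis by simp
  qed
  have Y: "6 / \<eta> * P \<le> 6 * H"
  proof -
    have "fbar * v \<le> 1 * 1" using fbar v by (intro mult_mono) auto
    then have "fbar * v \<le> sqrt (real k)" using k real_sqrt_ge_one[of "real k"] by linarith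
    then have "(6 * P / (\<eta> * (fbar * v))) * (fbar * v) \<le> (6 * P / (\<eta> * (fbar * v))) * sqrt (real k)"
      using P \<eta>(1) fbar v by (intro mult_left_mono) auto
    then show ?thesis unfolding H_def using fbar v by (simp add: mult_ac)
  qed
  have R: "sqrt (2 * real k + 2) / (1 - sqrt (exp 1) / 2) \<le> 20 * sqrt (real k)"
  proof -
    have "sqrt (2 * real k + 2) \<le> sqrt (4 * real k)" using k by (intro real_sqrt_le_mono) simp
    then have "sqrt (2 * real k + 2) / (1 - sqrt (exp 1) / 2) \<le> (2 * sqrt (real k)) / (1 / 10)"
      using sqrt_exp_1_le by (intro frac_le) (auto simp: real_sqrt_mult)
    then show ?thesis by simp
  qed
  have "F_1 k D \<sigma> \<eta> fbar f0 f1 \<le> (38 * H) * (20 * sqrt (real k)) * (900 / (\<sigma> ^ 6 * (1 - 3 * \<sigma>\<^sup>2)\<^sup>2)) ^ k"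
    unfolding F_1_def P_def[symmetric] pw
  proof (rule mult_mono[OF mult_mono[OF _ R] Q])
    show "(6 + 2 / fbar) * sqrt (4 * real k + 5 + 4 * real k / v\<^sup>2) * C_bar f0 f1 powr (5 / 4) + 6 / \<eta> * P \<le> 38 * H"
      using X Y by linarith
    have "0 \<le> 1 - sqrt (exp 1) / 2" using sqrt_exp_1_le by linarith
    then show "0 \<le> sqrt (2 * real k + 2) / (1 - sqrt (exp 1) / 2)" by (intro divide_nonneg_nonneg) simp_all
    show "0 \<le> 38 * H" "0 \<le> 38 * H * (20 * sqrt (real k))" using H by simp_all
    show "0 \<le> (F_max D \<sigma> / (F_min D \<sigma>)\<^sup>2) ^ k" using Fmax0 by simp
  qed
  also have "(38 * H) * (20 * sqrt (real k)) = 760 * (real k * P / (\<eta> * fbar * v))"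
    unfolding H_def by (simp add: field_simps)
  also have "\<dots> * (900 / (\<sigma> ^ 6 * (1 - 3 * \<sigma>\<^sup>2)\<^sup>2)) ^ k
      < 800 * (real k * P / (\<eta> * fbar * v)) * (900 / (\<sigma> ^ 6 * (1 - 3 * \<sigma>\<^sup>2)\<^sup>2)) ^ k"
    using Q0 k P \<eta>(1) fbar(1) v(1) by (intro mult_strict_right_mono) auto
  also have "800 * (real k * P / (\<eta> * fbar * v)) = 800 * real k * C_1 k fbar f0 f1 / (\<eta> * \<sigma>\<^sup>2)"
    unfolding C_1_def P_def v_def by (simp add: field_simps)
  finally show ?thesis .
qed

section \<open>The stability theorem\<close>

theorem theorem4:
  "\<exists>c1 c2 c3 c4 :: real. c1 > 0 \<and> c2 > 0 \<and> c3 > 0 \<and> c4 > 0 \<and>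
    (\<forall>(k::nat) (m::nat) (t :: nat \<Rightarrow> real) (s :: nat \<Rightarrow> real) (\<sigma>::real) (fbar::real) (f1::real) (\<epsilon>::real).
      k \<ge> 1 \<longrightarrow> m \<ge> 2 * k + 2 \<longrightarrow>
      strict_mono_on {1..k} t \<longrightarrow> t ` {1..k} \<subseteq> {0<..<1} \<longrightarrow>
      strict_mono_on {1..m} s \<longrightarrow> \<sigma> > 0 \<longrightarrow>
      0 < fbar \<longrightarrow> fbar < 1 \<longrightarrow> 0 < f1 \<longrightarrow>
      0 < \<epsilon> \<longrightarrow> \<epsilon> \<le> min_sep (t ` {1..k}) / 2 \<longrightarrow>
      (\<exists>f0_star \<ge> max 1 f1. \<forall>(\<eta>::real) > 0. \<forall>f0 > f0_star.
        gaussian_conditions k t m s \<sigma> \<eta> \<longrightarrow>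
        eta_small k (min_sep (t ` {1..k})) \<sigma> f0 f1 \<eta> \<longrightarrow>
        (\<forall>(a :: nat \<Rightarrow> real) (\<delta>::real) (noise :: nat \<Rightarrow> real) (y :: nat \<Rightarrow> real) (x :: real measure) (xhat :: real measure).
          (\<forall>i\<in>{1..k}. a i > 0) \<longrightarrow> x = discrete_measure k a t \<longrightarrow>
          \<delta> \<ge> 0 \<longrightarrow> (\<Sum>j=1..m. (noise j)\<^sup>2) \<le> \<delta>\<^sup>2 \<longrightarrow>
          (\<forall>j\<in>{1..m}. y j = (\<integral>\<tau>. gauss_window \<sigma> s j \<tau> \<partial>x) + noise j) \<longrightarrow>
          is_solution m (gauss_window \<sigma> s) y \<delta> xhat \<longrightarrow>
          d_GW x xhat \<le> F_1 k (min_sep (t ` {1..k})) \<sigma> \<eta> fbar f0 f1 * \<delta>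
                          + tv_norm (measure x) * \<epsilon>) \<and>
        (\<sigma> < 1 / sqrt 3 \<longrightarrow>
         min_sep (t ` {1..k}) > \<sigma> * sqrt (ln (5 / \<sigma>\<^sup>2)) \<longrightarrow>
         \<eta> \<le> min (c3 * \<sigma> ^ 6 * (1 - 3 * \<sigma>\<^sup>2) / (real k + 1) powr (3 / 2))
                 (c4 * C_bar f0 f1 powr (1 / 6) * \<sigma> powr (2 / 3) / (real k + 1) powr (1 / 3)) \<longrightarrow>
         F_1 k (min_sep (t ` {1..k})) \<sigma> \<eta> fbar f0 f1
           < c1 * real k * C_1 k fbar f0 f1 / (\<eta> * \<sigma>\<^sup>2)
               * (c2 / (\<sigma> ^ 6 * (1 - 3 * \<sigma>\<^sup>2)\<^sup>2)) ^ k)))"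
proof (rule exI[of _ 800], rule exI[of _ 900], rule exI[of _ 1], rule exI[of _ 1], intro conjI allI impI, goal_cases)
  case (5 k m t s \<sigma> fbar f1 \<epsilon>)
  have t: "inj_on t {1..k}" "t ` {1..k} \<subseteq> {0..1}"
    using strict_mono_on_imp_inj_on[OF 5(3)] 5(4) by fastforce+
  have m: "2 * k + 1 \<le> m" using 5(2) by simp
  define D where "D = min_sep (t ` {1..k})"
  obtain C where C: "C \<ge> 0" "\<forall>a \<delta> noise y z. (\<forall>i\<in>{1..k}. 0 \<le> a i) \<longrightarrow> 0 \<le> \<delta> \<longrightarrow> (\<Sum>j=1..m. (noise j)\<^sup>2) \<le> \<delta>\<^sup>2 \<longrightarrow>
     (\<forall>j\<in>{1..m}. y j = (\<integral>x. gauss_window \<sigma> s j x \<partial>discrete_measure k a t) + noise j) \<longrightarrow>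
     is_solution m (gauss_window \<sigma> s) y \<delta> z \<longrightarrow>
     d_GW (discrete_measure k a t) z \<le> C * \<delta> + \<epsilon> * (\<Sum>i=1..k. a i)"
    using gauss_stability[OF 5(5,6) t m 5(10)] by blast
  define G where "G = sqrt (2 * real k + 2) / (1 - sqrt (exp 1) / 2) * (F_max D \<sigma> / (F_min D \<sigma>)\<^sup>2) ^ k"
  (* G bounds F_1 below by 3 * f0 * G, which exceeds C beyond this threshold *)
  define f0_star where "f0_star = max (max 1 f1) (C / (3 * G))"
  have bound: "C \<le> F_1 k D \<sigma> \<eta> fbar f0 f1"
    if \<eta>: "0 < \<eta>" and f0: "f0_star < f0" and gc: "gaussian_conditions k t m s \<sigma> \<eta>"
      and es: "eta_small k D \<sigma> f0 f1 \<eta>" for \<eta> f0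
  proof -
    have "0 \<le> \<sigma> * sqrt (ln (3 + 4 / \<sigma>\<^sup>2))" using 5(6) by (simp add: add_increasing2)
    then have D: "0 < D" using gc unfolding gaussian_conditions_def D_def by linarith
    have "\<sigma>\<^sup>2 \<le> (sqrt 2)\<^sup>2"
      using gc 5(6) unfolding gaussian_conditions_def by (intro power_mono) auto
    moreover have "\<eta> \<le> \<sigma>\<^sup>2" using gc unfolding gaussian_conditions_def by blast
    ultimately have \<eta>2: "\<eta> \<le> 2" by simp
    have Fmax: "0 < F_max D \<sigma>" using F_max_pos[OF D 5(6)] .
    have "0 < F_min D \<sigma>" using F_min_pos_if_eta_small[OF \<eta> es D 5(6)] .
    then have "0 < (F_max D \<sigma> / (F_min D \<sigma>)\<^sup>2) ^ k" using Fmax by simp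
    moreover have "0 < 1 - sqrt (exp 1) / 2" using sqrt_exp_1_le by linarith
    then have "0 < sqrt (2 * real k + 2) / (1 - sqrt (exp 1) / 2)"
      by (intro divide_pos_pos) simp_all
    ultimately have G: "0 < G" unfolding G_def by (rule mult_pos_pos[rotated])
    have "0 < f0" "C / (3 * G) \<le> f0" using f0 unfolding f0_star_def by auto
    then have "C \<le> 3 * f0 * G" using G by (simp add: pos_divide_le_eq mult_ac)
    also have "\<dots> \<le> F_1 k D \<sigma> \<eta> fbar f0 f1"
      unfolding G_def using F_1_lower_bound[OF \<eta> \<eta>2 5(7) \<open>0 < f0\<close> 5(9)] Fmax by (simp add: less_imp_le)
    finally show ?thesis .
  qed
  show ?case
  proof (rule exI[of _ f0_star], intro conjI allI impI)
    show "max 1 f1 \<le> f0_star" unfolding f0_star_def by simp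
  next
    fix \<eta> f0 a \<delta> noise y x xhat
    assume H: "0 < \<eta>" "f0_star < f0" "gaussian_conditions k t m s \<sigma> \<eta>"
      "eta_small k (min_sep (t ` {1..k})) \<sigma> f0 f1 \<eta>"
      and a: "\<forall>i\<in>{1..k}. 0 < a i" and x: "x = discrete_measure k a t"
      and data: "0 \<le> \<delta>" "(\<Sum>j=1..m. (noise j)\<^sup>2) \<le> \<delta>\<^sup>2"
      "\<forall>j\<in>{1..m}. y j = (\<integral>\<tau>. gauss_window \<sigma> s j \<tau> \<partial>x) + noise j"
      "is_solution m (gauss_window \<sigma> s) y \<delta> xhat"
    have a0: "\<forall>i\<in>{1..k}. 0 \<le> a i" using a by (simp add: less_imp_le)
    have tv: "tv_norm (measure x) = (\<Sum>i=1..k. a i)"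
      unfolding x using tv_norm_measure[OF discrete_measure_nonneg[OF t(2) a0]] mass_discrete_measure[OF t(2) a0] by simp
    have "d_GW x xhat \<le> C * \<delta> + \<epsilon> * (\<Sum>i=1..k. a i)"
      using C(2) a0 data unfolding x by blast
    also have "C * \<delta> \<le> F_1 k D \<sigma> \<eta> fbar f0 f1 * \<delta>"
      using bound H data(1) unfolding D_def by (intro mult_right_mono) blast+
    finally show "d_GW x xhat \<le> F_1 k (min_sep (t ` {1..k})) \<sigma> \<eta> fbar f0 f1 * \<delta> + tv_norm (measure x) * \<epsilon>"
      unfolding tv D_def by (simp add: mult.commute)
  next
    fix \<eta> f0 :: real
    assume H: "0 < \<eta>" "f0_star < f0" "gaussian_conditions k t m s \<sigma> \<eta>"
      "\<sigma> < 1 / sqrt 3" "\<sigma> * sqrt (ln (5 / \<sigma>\<^sup>2)) < min_sep (t ` {1..k})"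
    have "\<eta> \<le> \<sigma>\<^sup>2" using H(3) unfolding gaussian_conditions_def by blast
    moreover have "0 < f0" using H(2) unfolding f0_star_def by linarith
    ultimately show "F_1 k (min_sep (t ` {1..k})) \<sigma> \<eta> fbar f0 f1
           < 800 * real k * C_1 k fbar f0 f1 / (\<eta> * \<sigma>\<^sup>2)
               * (900 / (\<sigma> ^ 6 * (1 - 3 * \<sigma>\<^sup>2)\<^sup>2)) ^ k"
      using H 5 by (intro F_1_upper_bound) auto
  qed
qed simp_all

end
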